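(* Let $R$ be a totally ordered set, let $\mathcal{P}=\mathcal{P}_R$ be the category of persistence modules of finite type indexed by $R$, and let $\mathcal{B}=\mathcal{B}_R$ be the category of finite barcodes with endpoints in $R$. The functors $\mathrm{bar}\colon\mathcal{P}\to\mathcal{B}$ (defined with any choice of interval decompositions as described in the context) and $\mathbb{I}\colon\mathcal{B}\to\mathcal{P}$ form an equivalence of categories between $\mathcal{P}$ and $\mathcal{B}$.
   Context: Fix a field $F$; all vector spaces are over $F$. A persistence module indexed by $R$ is a functor from the totally ordered set $R$ (viewed as a category) to vector spaces; morphisms are natural transformations; direct sums are pointwise. A cut of $R$ is a pair $c=(c^\downarrow,c^\uparrow)$ of (possibly empty) subsets with $c^\downarrow\cup c^\uparrow=R$ and $r_1<r_2$ for all $r_1\in c^\downarrow$, $r_2\in c^\uparrow$. Cuts are ordered by $c_1\le c_2$ iff $c_1^\downarrow\subseteq c_2^\downarrow$. For cuts $b\le d$, $\lceil b,d\rfloor=b^\uparrow\cap d^\downarrow$; $-\infty$ denotes the cut $(\varnothing,R)$, so $\lceil -\infty,d\rfloor=d^\downarrow$. The interval module $\mathbb{I}\lceil b,d\rfloor$ is $F$ at $t\in\lceil b,d\rfloor$ and $0$ elsewhere, with identity structure maps inside the interval and zero maps otherwise (it is the zero module if $b=d$). A persistence module is of finite type if it is isomorphic to a finite direct sum of interval modules. The category $\mathcal{B}_R$: objects are finite indexed multisets $\{(b_i,d_i)\}_{i\in I}$ of ordered pairs of cuts of $R$ with $b_i\le d_i$. Hom-sets are $$\mathcal{B}_R\big(\{(b'_j,d'_j)\}_{j\in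 J},\{(b_i,d_i)\}_{i\in I}\big)=\big\{\{x_{i,j}\}_{i\in I,j\in J}\mid x_{i,j}\in F,\ x_{i,j}=0\text{ if }b_i>b'_j\text{ or }d_i>d'_j\big\}\big/\sim,$$ where $\{x_{i,j}\}\sim\{x'_{i,j}\}$ if $x_{i,j}=x'_{i,j}$ whenever $b'_j<d_i$. The class of $X$ is written $[X]$; composition is $[X][Y]=[XY]$ (this is well defined). Elements of $\big(\bigoplus_{i\in I}\mathbb{I}\lceil b_i,d_i\rfloor\big)_t$ are represented by equivalence classes $[v]$ of vectors $v=\{v_i\}_{i\in I}$ over $F$ with $v_i=0$ if $t\in\lceil-\infty,b_i\rfloor$, where $v$ and $v'$ are equivalent iff $v_i=v'_i$ for all $i$ with $t\in\lceil-\infty,d_i\rfloor$. A morphism $\varphi\colon\bigoplus_{j\in J}\mathbb{I}\lceil b'_j,d'_j\rfloor\to\bigoplus_{i\in I}\mathbb{I}\lceil b_i,d_i\rfloor$ is computed by (multiplication by) the matrix $X$ if $\varphi_t([u])=[Xu]$ for all $t$ and all $[u]$. The functor $\mathbb{I}$: $\mathbb{I}(\{(b_i,d_i)\}_{i\in I})=\bigoplus_{i\in I}\mathbb{I}\lceil b_i,d_i\rfloor$, and for $[X]\colon\{(b'_j,d'_j)\}_{j\in J}\to\{(b_i,d_i)\}_{i\in I}$, $\mathbb{I}([X])$ is the morphism $\bigoplus_{j\in J}\mathbb{I}\lceil b'_j,d'_j\rfloor\to\bigoplus_{i\in I}\mathbb{I}\lceil b_i,d_i\rfloor$ computed by the matrix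 $X$. The functor $\mathrm{bar}$: suppose all persistence modules of finite type are identified with persistence modules of the form $\bigoplus_{i\in I}\mathbb{I}\lceil b_i,d_i\rfloor$ by fixed isomorphisms, with $\mathbb{I}(\{(b_i,d_i)\}_{i\in I})$ being identified with itself by the identity morphism in each case. Given a persistence module $V$ of finite type and the chosen isomorphism $V\cong\bigoplus_{i\in I}\mathbb{I}\lceil b_i,d_i\rfloor$, let $\mathrm{bar}(V)=\{(b_i,d_i)\}_{i\in I}$. If $\varphi\colon U\to V$ is a morphism of persistence modules of finite type with $\mathrm{bar}(U)=\{(b'_j,d'_j)\}_{j\in J}$ and $\mathrm{bar}(V)=\{(b_i,d_i)\}_{i\in I}$, let $\widetilde\varphi$ be the composite $\bigoplus_{j\in J}\mathbb{I}\lceil b'_j,d'_j\rfloor\xrightarrow{\cong}U\xrightarrow{\varphi}V\xrightarrow{\cong}\bigoplus_{i\in I}\mathbb{I}\lceil b_i,d_i\rfloor$ with the chosen isomorphisms, and let $\mathrm{bar}(\varphi)\colon\mathrm{bar}(U)\to\mathrm{bar}(V)$ be the class of a matrix $X$ such that $\widetilde\varphi$ is computed by multiplication by $X$ (this class is uniquely determined). *)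

theory Defs
  imports "HOL-Algebra.Module"
begin

section \<open>Categories, functors, equivalences\<close>

text \<open>
  Hom-sets are not required to be disjoint, so an arrow does not determine its source and target
  and composition takes the objects as arguments: \<open>Cmp C A B D g f\<close> is \<open>g \<circ> f\<close> for
  \<open>f : A \<rightarrow> B\<close> and \<open>g : B \<rightarrow> D\<close>.
\<close>

record ('o, 'a) cat =
  Ob  :: "'o set"
  Hom :: "'o \<Rightarrow> 'o \<Rightarrow> 'a set"
  Idn :: "'o \<Rightarrow> 'a"
  Cmp :: "'o \<Rightarrow> 'o \<Rightarrow> 'o \<Rightarrow> 'a \<Rightarrow> 'a \<Rightarrow> 'a"

locale category =
  fixes C :: "('o, 'a) cat"
  assumes Idn_in_Hom: "A \<in> Ob C \<Longrightarrow> Idn C A \<in> Hom C A A"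
    and Cmp_in_Hom: "\<lbrakk>A \<in> Ob C; B \<in> Ob C; D \<in> Ob C; f \<in> Hom C A B; g \<in> Hom C B D\<rbrakk>
      \<Longrightarrow> Cmp C A B D g f \<in> Hom C A D"
    and Cmp_Idn_left: "\<lbrakk>A \<in> Ob C; B \<in> Ob C; f \<in> Hom C A B\<rbrakk>
      \<Longrightarrow> Cmp C A B B (Idn C B) f = f"
    and Cmp_Idn_right: "\<lbrakk>A \<in> Ob C; B \<in> Ob C; f \<in> Hom C A B\<rbrakk>
      \<Longrightarrow> Cmp C A A B f (Idn C A) = f"
    and Cmp_assoc: "\<lbrakk>A \<in> Ob C; B \<in> Ob C; D \<in> Ob C; E \<in> Ob C;
        f \<in> Hom C A B; g \<in> Hom C B D; h \<in> Hom C D E\<rbrakk>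
      \<Longrightarrow> Cmp C A D E h (Cmp C A B D g f) = Cmp C A B E (Cmp C B D E h g) f"

definition inverse_arrows :: "('o, 'a) cat \<Rightarrow> 'o \<Rightarrow> 'o \<Rightarrow> 'a \<Rightarrow> 'a \<Rightarrow> bool" where
  "inverse_arrows C A B f g \<longleftrightarrow> f \<in> Hom C A B \<and> g \<in> Hom C B A \<and>
     Cmp C A B A g f = Idn C A \<and> Cmp C B A B f g = Idn C B"

definition iso_arrow :: "('o, 'a) cat \<Rightarrow> 'o \<Rightarrow> 'o \<Rightarrow> 'a \<Rightarrow> bool" where
  "iso_arrow C A B f \<longleftrightarrow> (\<exists>g. inverse_arrows C A B f g)"

definition inverse_arrow :: "('o, 'a) cat \<Rightarrow> 'o \<Rightarrow> 'o \<Rightarrow> 'a \<Rightarrow> 'a" where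
  "inverse_arrow C A B f = (THE g. inverse_arrows C A B f g)"

definition isomorphic_objects :: "('o, 'a) cat \<Rightarrow> 'o \<Rightarrow> 'o \<Rightarrow> bool" where
  "isomorphic_objects C A B \<longleftrightarrow> (\<exists>f. iso_arrow C A B f)"

definition full_subcategory :: "('o, 'a) cat \<Rightarrow> ('o \<Rightarrow> bool) \<Rightarrow> ('o, 'a) cat" where
  "full_subcategory C P = C\<lparr>Ob := {A \<in> Ob C. P A}\<rparr>"

text \<open>\<open>FArr G A B f\<close> is the image under \<open>G\<close> of the arrow \<open>f : A \<rightarrow> B\<close>.\<close>

record ('o, 'a, 'p, 'b) func =
  FOb  :: "'o \<Rightarrow> 'p"
  FArr :: "'o \<Rightarrow> 'o \<Rightarrow> 'a \<Rightarrow> 'b"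

locale is_functor = source: category C + target: category D
  for C :: "('o, 'a) cat" and D :: "('p, 'b) cat" +
  fixes G :: "('o, 'a, 'p, 'b) func"
  assumes FOb_in_Ob: "A \<in> Ob C \<Longrightarrow> FOb G A \<in> Ob D"
    and FArr_in_Hom: "\<lbrakk>A \<in> Ob C; B \<in> Ob C; f \<in> Hom C A B\<rbrakk>
      \<Longrightarrow> FArr G A B f \<in> Hom D (FOb G A) (FOb G B)"
    and FArr_Idn: "A \<in> Ob C \<Longrightarrow> FArr G A A (Idn C A) = Idn D (FOb G A)"
    and FArr_Cmp: "\<lbrakk>A \<in> Ob C; B \<in> Ob C; E \<in> Ob C; f \<in> Hom C A B; g \<in> Hom C B E\<rbrakk>
      \<Longrightarrow> FArr G A E (Cmp C A B E g f) =
          Cmp D (FOb G A) (FOb G B) (FOb G E) (FArr G B E g) (FArr G A B f)"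

definition id_func :: "('o, 'a, 'o, 'a) func" where
  "id_func = \<lparr>FOb = (\<lambda>A. A), FArr = (\<lambda>A B f. f)\<rparr>"

definition comp_func ::
    "('p, 'b, 'q, 'c) func \<Rightarrow> ('o, 'a, 'p, 'b) func \<Rightarrow> ('o, 'a, 'q, 'c) func" where
  "comp_func H G = \<lparr>FOb = (\<lambda>A. FOb H (FOb G A)),
     FArr = (\<lambda>A B f. FArr H (FOb G A) (FOb G B) (FArr G A B f))\<rparr>"

definition natural_iso ::
    "('o, 'a) cat \<Rightarrow> ('p, 'b) cat \<Rightarrow> ('o, 'a, 'p, 'b) func \<Rightarrow> ('o, 'a, 'p, 'b) func
      \<Rightarrow> ('o \<Rightarrow> 'b) \<Rightarrow> bool" where
  "natural_iso C D G H \<eta> \<longleftrightarrow>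
     (\<forall>A\<in>Ob C. iso_arrow D (FOb G A) (FOb H A) (\<eta> A)) \<and>
     (\<forall>A\<in>Ob C. \<forall>B\<in>Ob C. \<forall>f\<in>Hom C A B.
        Cmp D (FOb G A) (FOb G B) (FOb H B) (\<eta> B) (FArr G A B f) =
        Cmp D (FOb G A) (FOb H A) (FOb H B) (FArr H A B f) (\<eta> A))"

definition equivalence_of_categories ::
    "('o, 'a) cat \<Rightarrow> ('p, 'b) cat \<Rightarrow> ('o, 'a, 'p, 'b) func \<Rightarrow> ('p, 'b, 'o, 'a) func \<Rightarrow> bool"
  where
  "equivalence_of_categories C D G H \<longleftrightarrow>
     is_functor C D G \<and> is_functor D C H \<and>
     (\<exists>\<eta>. natural_iso C C (comp_func H G) id_func \<eta>) \<and>
     (\<exists>\<epsilon>. natural_iso D D (comp_func G H) id_func \<epsilon>)"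

section \<open>Persistence modules\<close>

text \<open>
  A vector space over the field \<open>F\<close> is a \<open>module F V\<close>; the multiplicative part of the
  record \<open>V\<close> is irrelevant there and is left \<open>undefined\<close> in the constructions below.
  Linear maps are extensional, so that equal maps are equal as functions.
\<close>

definition linear_maps :: "'f ring \<Rightarrow> ('f, 'v) module \<Rightarrow> ('f, 'w) module \<Rightarrow> ('v \<Rightarrow> 'w) set" where
  "linear_maps F V W = {f \<in> carrier V \<rightarrow>\<^sub>E carrier W.
     (\<forall>x\<in>carrier V. \<forall>y\<in>carrier V. f (x \<oplus>\<^bsub>V\<^esub> y) = f x \<oplus>\<^bsub>W\<^esub> f y) \<and>
     (\<forall>a\<in>carrier F. \<forall>x\<in>carrier V. f (a \<odot>\<^bsub>V\<^esub> x) = a \<odot>\<^bsub>W\<^esub> f x)}"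

text \<open>
  The totally ordered set is an arbitrary, possibly empty, subset \<open>R\<close> of a linear order.
\<close>

record ('r, 'f, 'v) pmod =
  Space :: "'r \<Rightarrow> ('f, 'v) module"
  Tr    :: "'r \<Rightarrow> 'r \<Rightarrow> 'v \<Rightarrow> 'v"

definition persistence_module ::
    "'f ring \<Rightarrow> 'r::linorder set \<Rightarrow> ('r, 'f, 'v) pmod \<Rightarrow> bool" where
  "persistence_module F R V \<longleftrightarrow>
     (\<forall>t\<in>R. module F (Space V t)) \<and>
     (\<forall>s\<in>R. \<forall>t\<in>R. s \<le> t \<longrightarrow> Tr V s t \<in> linear_maps F (Space V s) (Space V t)) \<and>
     (\<forall>t\<in>R. Tr V t t = (\<lambda>x\<in>carrier (Space V t). x)) \<and>
     (\<forall>s\<in>R. \<forall>t\<in>R. \<forall>u\<in>R. s \<le> t \<longrightarrow> t \<le> u \<longrightarrow>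
        Tr V s u = compose (carrier (Space V s)) (Tr V t u) (Tr V s t))"

definition pmod_morphisms ::
    "'f ring \<Rightarrow> 'r::linorder set \<Rightarrow> ('r, 'f, 'v) pmod \<Rightarrow> ('r, 'f, 'v) pmod
      \<Rightarrow> ('r \<Rightarrow> 'v \<Rightarrow> 'v) set" where
  "pmod_morphisms F R U V =
     {\<phi> \<in> (\<Pi>\<^sub>E t\<in>R. linear_maps F (Space U t) (Space V t)).
        \<forall>s\<in>R. \<forall>t\<in>R. s \<le> t \<longrightarrow>
          compose (carrier (Space U s)) (\<phi> t) (Tr U s t) =
          compose (carrier (Space U s)) (Tr V s t) (\<phi> s)}"

definition pmod_category ::
    "'f ring \<Rightarrow> 'r::linorder set \<Rightarrow> (('r, 'f, 'v) pmod, 'r \<Rightarrow> 'v \<Rightarrow> 'v) cat" where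
  "pmod_category F R =
     \<lparr>Ob = {V. persistence_module F R V},
      Hom = pmod_morphisms F R,
      Idn = (\<lambda>V. \<lambda>t\<in>R. \<lambda>x\<in>carrier (Space V t). x),
      Cmp = (\<lambda>U V W \<psi> \<phi>. \<lambda>t\<in>R. compose (carrier (Space U t)) (\<psi> t) (\<phi> t))\<rparr>"

definition pmod_direct_sum :: "'i set \<Rightarrow> ('i \<Rightarrow> ('r, 'f, 'v) pmod) \<Rightarrow> ('r, 'f, 'i \<Rightarrow> 'v) pmod"
  \<comment> \<open>used for finite \<open>I\<close> only, where direct sum and product agree\<close>
  where
  "pmod_direct_sum I M =
     \<lparr>Space = (\<lambda>t. \<lparr>carrier = (\<Pi>\<^sub>E i\<in>I. carrier (Space (M i) t)),
        mult = undefined, one = undefined,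
        zero = (\<lambda>i\<in>I. \<zero>\<^bsub>Space (M i) t\<^esub>),
        add = (\<lambda>x y. \<lambda>i\<in>I. x i \<oplus>\<^bsub>Space (M i) t\<^esub> y i),
        smult = (\<lambda>a x. \<lambda>i\<in>I. a \<odot>\<^bsub>Space (M i) t\<^esub> x i)\<rparr>),
      Tr = (\<lambda>s t. \<lambda>x\<in>(\<Pi>\<^sub>E i\<in>I. carrier (Space (M i) s)). \<lambda>i\<in>I. Tr (M i) s t (x i))\<rparr>"

text \<open>Transport of structure along an injection \<open>e\<close> of the underlying sets.\<close>

definition pmod_transport :: "('w \<Rightarrow> 'v) \<Rightarrow> ('r, 'f, 'w) pmod \<Rightarrow> ('r, 'f, 'v) pmod" where
  "pmod_transport e M =
     \<lparr>Space = (\<lambda>t. \<lparr>carrier = e ` carrier (Space M t),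
        mult = undefined, one = undefined,
        zero = e \<zero>\<^bsub>Space M t\<^esub>,
        add = (\<lambda>x y. e (the_inv e x \<oplus>\<^bsub>Space M t\<^esub> the_inv e y)),
        smult = (\<lambda>a x. e (a \<odot>\<^bsub>Space M t\<^esub> the_inv e x))\<rparr>),
      Tr = (\<lambda>s t. \<lambda>x\<in>e ` carrier (Space M s). e (Tr M s t (the_inv e x)))\<rparr>"

section \<open>Cuts, barcodes and interval modules\<close>

type_synonym 'r cut = "'r set \<times> 'r set"

abbreviation lower_part :: "'r cut \<Rightarrow> 'r set" where "lower_part \<equiv> fst"
abbreviation upper_part :: "'r cut \<Rightarrow> 'r set" where "upper_part \<equiv> snd"

definition cuts :: "'r::linorder set \<Rightarrow> 'r cut set" where
  "cuts R = {c. lower_part c \<union> upper_part c = R \<and>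
     (\<forall>r1\<in>lower_part c. \<forall>r2\<in>upper_part c. r1 < r2)}"

definition cut_le :: "'r cut \<Rightarrow> 'r cut \<Rightarrow> bool" where
  "cut_le c1 c2 \<longleftrightarrow> lower_part c1 \<subseteq> lower_part c2"

definition cut_less :: "'r cut \<Rightarrow> 'r cut \<Rightarrow> bool" where
  "cut_less c1 c2 \<longleftrightarrow> cut_le c1 c2 \<and> c1 \<noteq> c2"

definition cut_interval :: "'r cut \<Rightarrow> 'r cut \<Rightarrow> 'r set" where
  "cut_interval b d = upper_part b \<inter> lower_part d"

definition minus_infinity :: "'r set \<Rightarrow> 'r cut" where
  "minus_infinity R = ({}, R)"

text \<open>
  A finite indexed multiset of pairs of cuts, with index set a finite subset of the type \<open>'i\<close>,
  is a partial map with finite domain.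
\<close>

type_synonym ('i, 'r) barcode = "'i \<rightharpoonup> ('r cut \<times> 'r cut)"

definition birth :: "('i, 'r) barcode \<Rightarrow> 'i \<Rightarrow> 'r cut" where
  "birth \<beta> i = fst (the (\<beta> i))"

definition death :: "('i, 'r) barcode \<Rightarrow> 'i \<Rightarrow> 'r cut" where
  "death \<beta> i = snd (the (\<beta> i))"

definition barcodes :: "'r::linorder set \<Rightarrow> ('i, 'r) barcode set" where
  "barcodes R = {\<beta>. finite (dom \<beta>) \<and>
     (\<forall>i\<in>dom \<beta>. birth \<beta> i \<in> cuts R \<and> death \<beta> i \<in> cuts R \<and> cut_le (birth \<beta> i) (death \<beta> i))}"

definition interval_module :: "'f ring \<Rightarrow> 'r cut \<Rightarrow> 'r cut \<Rightarrow> ('r, 'f, 'f) pmod" where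
  "interval_module F b d =
     (let K = (\<lambda>t. if t \<in> cut_interval b d then carrier F else {\<zero>\<^bsub>F\<^esub>}) in
     \<lparr>Space = (\<lambda>t. \<lparr>carrier = K t, mult = undefined, one = undefined,
        zero = \<zero>\<^bsub>F\<^esub>, add = (\<lambda>x y. x \<oplus>\<^bsub>F\<^esub> y), smult = (\<lambda>a x. a \<otimes>\<^bsub>F\<^esub> x)\<rparr>),
      Tr = (\<lambda>s t. \<lambda>x\<in>K s.
        if s \<in> cut_interval b d \<and> t \<in> cut_interval b d then x else \<zero>\<^bsub>F\<^esub>)\<rparr>)"

text \<open>
  The vector spaces under consideration have their underlying sets in a fixed but arbitrary type
  \<open>'v\<close>, which has to contain the spaces of the direct sums of interval modules, whose elements are
  families \<open>'i \<Rightarrow> 'f\<close>. They are placed in \<open>'v\<close> by an injection \<open>e :: ('i \<Rightarrow> 'f) \<Rightarrow> 'v\<close>.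
\<close>

definition interval_sum ::
    "'f ring \<Rightarrow> (('i \<Rightarrow> 'f) \<Rightarrow> 'v) \<Rightarrow> ('i, 'r) barcode \<Rightarrow> ('r, 'f, 'v) pmod" where
  "interval_sum F e \<beta> = pmod_transport e
     (pmod_direct_sum (dom \<beta>) (\<lambda>i. interval_module F (birth \<beta> i) (death \<beta> i)))"

definition finite_type ::
    "'f ring \<Rightarrow> 'r::linorder set \<Rightarrow> (('i \<Rightarrow> 'f) \<Rightarrow> 'v) \<Rightarrow> ('r, 'f, 'v) pmod \<Rightarrow> bool" where
  "finite_type F R e V \<longleftrightarrow>
     (\<exists>\<beta>\<in>barcodes R. isomorphic_objects (pmod_category F R) V (interval_sum F e \<beta>))"

definition Pcat ::
    "'f ring \<Rightarrow> 'r::linorder set \<Rightarrow> (('i \<Rightarrow> 'f) \<Rightarrow> 'v)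
      \<Rightarrow> (('r, 'f, 'v) pmod, 'r \<Rightarrow> 'v \<Rightarrow> 'v) cat" where
  "Pcat F R e = full_subcategory (pmod_category F R) (finite_type F R e)"

section \<open>The category of finite barcodes\<close>

text \<open>
  A matrix of an arrow from \<open>\<beta>'\<close> to \<open>\<beta>\<close> has its rows indexed by \<open>dom \<beta>\<close> and its columns by
  \<open>dom \<beta>'\<close>.
\<close>

definition matrices ::
    "'f ring \<Rightarrow> ('i, 'r) barcode \<Rightarrow> ('i, 'r) barcode \<Rightarrow> ('i \<times> 'i \<Rightarrow> 'f) set" where
  "matrices F \<beta>' \<beta> = {X \<in> (dom \<beta> \<times> dom \<beta>') \<rightarrow>\<^sub>E carrier F.
     \<forall>i\<in>dom \<beta>. \<forall>j\<in>dom \<beta>'.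
       cut_less (birth \<beta>' j) (birth \<beta> i) \<or> cut_less (death \<beta>' j) (death \<beta> i) \<longrightarrow>
       X (i, j) = \<zero>\<^bsub>F\<^esub>}"

definition matrix_rel ::
    "'f ring \<Rightarrow> ('i, 'r) barcode \<Rightarrow> ('i, 'r) barcode
      \<Rightarrow> (('i \<times> 'i \<Rightarrow> 'f) \<times> ('i \<times> 'i \<Rightarrow> 'f)) set" where
  "matrix_rel F \<beta>' \<beta> = {(X, X'). X \<in> matrices F \<beta>' \<beta> \<and> X' \<in> matrices F \<beta>' \<beta> \<and>
     (\<forall>i\<in>dom \<beta>. \<forall>j\<in>dom \<beta>'. cut_less (birth \<beta>' j) (death \<beta> i) \<longrightarrow> X (i, j) = X' (i, j))}"

definition matrix_class ::
    "'f ring \<Rightarrow> ('i, 'r) barcode \<Rightarrow> ('i, 'r) barcode \<Rightarrow> ('i \<times> 'i \<Rightarrow> 'f)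
      \<Rightarrow> ('i \<times> 'i \<Rightarrow> 'f) set" where
  "matrix_class F \<beta>' \<beta> X = matrix_rel F \<beta>' \<beta> `` {X}"

definition matrix_mult ::
    "'f ring \<Rightarrow> 'i set \<Rightarrow> 'i set \<Rightarrow> 'i set \<Rightarrow> ('i \<times> 'i \<Rightarrow> 'f) \<Rightarrow> ('i \<times> 'i \<Rightarrow> 'f)
      \<Rightarrow> ('i \<times> 'i \<Rightarrow> 'f)" where
  "matrix_mult F I J K X Y =
     (\<lambda>(i, k)\<in>I \<times> K. \<Oplus>\<^bsub>F\<^esub>j\<in>J. X (i, j) \<otimes>\<^bsub>F\<^esub> Y (j, k))"

definition identity_matrix :: "'f ring \<Rightarrow> 'i set \<Rightarrow> ('i \<times> 'i \<Rightarrow> 'f)" where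
  "identity_matrix F I = (\<lambda>(i, j)\<in>I \<times> I. if i = j then \<one>\<^bsub>F\<^esub> else \<zero>\<^bsub>F\<^esub>)"

definition Bcat ::
    "'f ring \<Rightarrow> 'r::linorder set \<Rightarrow> (('i, 'r) barcode, ('i \<times> 'i \<Rightarrow> 'f) set) cat" where
  "Bcat F R =
     \<lparr>Ob = barcodes R,
      Hom = (\<lambda>\<beta>' \<beta>. matrices F \<beta>' \<beta> // matrix_rel F \<beta>' \<beta>),
      Idn = (\<lambda>\<beta>. matrix_class F \<beta> \<beta> (identity_matrix F (dom \<beta>))),
      Cmp = (\<lambda>\<alpha> \<beta> \<gamma> x y. \<Union>X\<in>x. \<Union>Y\<in>y.
        matrix_class F \<alpha> \<gamma> (matrix_mult F (dom \<gamma>) (dom \<beta>) (dom \<alpha>) X Y))\<rparr>"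

section \<open>The functors\<close>

definition vectors ::
    "'f ring \<Rightarrow> 'r set \<Rightarrow> ('i, 'r) barcode \<Rightarrow> 'r \<Rightarrow> ('i \<Rightarrow> 'f) set" where
  "vectors F R \<beta> t = {v \<in> dom \<beta> \<rightarrow>\<^sub>E carrier F.
     \<forall>i\<in>dom \<beta>. t \<in> cut_interval (minus_infinity R) (birth \<beta> i) \<longrightarrow> v i = \<zero>\<^bsub>F\<^esub>}"

text \<open>
  The element of the direct sum of interval modules represented by the class of a vector \<open>v\<close>:
  the coordinates outside their interval, which are irrelevant for the class or zero already,
  are set to zero. The lemma after it shows that this identifies exactly the vectors
  which agree in all coordinates \<open>i\<close> with \<open>t \<in> \<lceil>-\<infinity>, d\<^sub>i\<rfloor>\<close>.
\<close>

definition vector_element ::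
    "'f ring \<Rightarrow> (('i \<Rightarrow> 'f) \<Rightarrow> 'v) \<Rightarrow> ('i, 'r) barcode \<Rightarrow> 'r \<Rightarrow> ('i \<Rightarrow> 'f) \<Rightarrow> 'v" where
  "vector_element F e \<beta> t v =
     e (\<lambda>i\<in>dom \<beta>. if t \<in> cut_interval (birth \<beta> i) (death \<beta> i) then v i else \<zero>\<^bsub>F\<^esub>)"

lemma vector_element_eq_iff:
  assumes "inj e" "\<beta> \<in> barcodes R" "t \<in> R" "v \<in> vectors F R \<beta> t" "v' \<in> vectors F R \<beta> t"
  shows "vector_element F e \<beta> t v = vector_element F e \<beta> t v' \<longleftrightarrow>
    (\<forall>i\<in>dom \<beta>. t \<in> cut_interval (minus_infinity R) (death \<beta> i) \<longrightarrow> v i = v' i)"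
proof -
  let ?w = "\<lambda>v. \<lambda>i\<in>dom \<beta>. if t \<in> cut_interval (birth \<beta> i) (death \<beta> i) then v i else \<zero>\<^bsub>F\<^esub>"
  have "vector_element F e \<beta> t v = vector_element F e \<beta> t v' \<longleftrightarrow> ?w v = ?w v'"
    unfolding vector_element_def using assms(1) by (rule inj_eq)
  also have "\<dots> \<longleftrightarrow> (\<forall>i\<in>dom \<beta>. ?w v i = ?w v' i)"
    by (metis (no_types, lifting) restrict_ext restrict_apply')
  also have "\<dots> \<longleftrightarrow>
      (\<forall>i\<in>dom \<beta>. t \<in> cut_interval (minus_infinity R) (death \<beta> i) \<longrightarrow> v i = v' i)"
  proof (rule ball_cong[OF refl])
    fix i assume i: "i \<in> dom \<beta>"
    then have b: "t \<in> lower_part (birth \<beta> i) \<or> t \<in> upper_part (birth \<beta> i)"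
      using assms(2,3) by (auto simp: barcodes_def cuts_def)
    have "v i = \<zero>\<^bsub>F\<^esub> \<and> v' i = \<zero>\<^bsub>F\<^esub>" if "t \<in> lower_part (birth \<beta> i)"
      using assms(3-5) i that
      by (simp add: vectors_def cut_interval_def minus_infinity_def)
    then show "(?w v i = ?w v' i) =
      (t \<in> cut_interval (minus_infinity R) (death \<beta> i) \<longrightarrow> v i = v' i)"
      using b i assms(3) by (auto simp: cut_interval_def minus_infinity_def)
  qed
  finally show ?thesis .
qed

definition matrix_vector ::
    "'f ring \<Rightarrow> 'i set \<Rightarrow> 'i set \<Rightarrow> ('i \<times> 'i \<Rightarrow> 'f) \<Rightarrow> ('i \<Rightarrow> 'f) \<Rightarrow> ('i \<Rightarrow> 'f)" where
  "matrix_vector F I J X u = (\<lambda>i\<in>I. \<Oplus>\<^bsub>F\<^esub>j\<in>J. X (i, j) \<otimes>\<^bsub>F\<^esub> u j)"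

definition computed_by ::
    "'f ring \<Rightarrow> 'r set \<Rightarrow> (('i \<Rightarrow> 'f) \<Rightarrow> 'v) \<Rightarrow> ('i, 'r) barcode \<Rightarrow> ('i, 'r) barcode
      \<Rightarrow> ('r \<Rightarrow> 'v \<Rightarrow> 'v) \<Rightarrow> ('i \<times> 'i \<Rightarrow> 'f) \<Rightarrow> bool" where
  "computed_by F R e \<beta>' \<beta> \<phi> X \<longleftrightarrow>
     (\<forall>t\<in>R. \<forall>u\<in>vectors F R \<beta>' t.
        \<phi> t (vector_element F e \<beta>' t u) =
        vector_element F e \<beta> t (matrix_vector F (dom \<beta>) (dom \<beta>') X u))"

definition interval_functor ::
    "'f ring \<Rightarrow> 'r::linorder set \<Rightarrow> (('i \<Rightarrow> 'f) \<Rightarrow> 'v)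
      \<Rightarrow> (('i, 'r) barcode, ('i \<times> 'i \<Rightarrow> 'f) set, ('r, 'f, 'v) pmod, 'r \<Rightarrow> 'v \<Rightarrow> 'v) func" where
  "interval_functor F R e =
     \<lparr>FOb = interval_sum F e,
      FArr = (\<lambda>\<beta>' \<beta> x. THE \<phi>.
        \<phi> \<in> pmod_morphisms F R (interval_sum F e \<beta>') (interval_sum F e \<beta>) \<and>
        (\<exists>X\<in>x. computed_by F R e \<beta>' \<beta> \<phi> X))\<rparr>"

text \<open>
  A choice of interval decompositions: \<open>\<theta> V\<close> is an isomorphism from \<open>V\<close> to the direct sum of
  interval modules given by the barcode \<open>bc V\<close>. Different barcodes may have the same direct sum
  of interval modules (for instance \<open>{(c, c)}\<close> and \<open>{(c', c')}\<close> both give the zero module), so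
  it cannot be demanded that \<open>bc\<close> is a left inverse of \<open>interval_sum F e\<close>; what is demanded is
  that a direct sum of interval modules is identified with itself by the identity.
\<close>

definition interval_decompositions ::
    "'f ring \<Rightarrow> 'r::linorder set \<Rightarrow> (('i \<Rightarrow> 'f) \<Rightarrow> 'v)
      \<Rightarrow> (('r, 'f, 'v) pmod \<Rightarrow> ('i, 'r) barcode)
      \<Rightarrow> (('r, 'f, 'v) pmod \<Rightarrow> 'r \<Rightarrow> 'v \<Rightarrow> 'v) \<Rightarrow> bool" where
  "interval_decompositions F R e bc \<theta> \<longleftrightarrow>
     (\<forall>V\<in>Ob (Pcat F R e). bc V \<in> barcodes R \<and>
        iso_arrow (Pcat F R e) V (interval_sum F e (bc V)) (\<theta> V)) \<and>
     (\<forall>\<beta>\<in>barcodes R. interval_sum F e (bc (interval_sum F e \<beta>)) = interval_sum F e \<beta> \<and>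
        \<theta> (interval_sum F e \<beta>) = Idn (Pcat F R e) (interval_sum F e \<beta>))"

definition bar_functor ::
    "'f ring \<Rightarrow> 'r::linorder set \<Rightarrow> (('i \<Rightarrow> 'f) \<Rightarrow> 'v)
      \<Rightarrow> (('r, 'f, 'v) pmod \<Rightarrow> ('i, 'r) barcode)
      \<Rightarrow> (('r, 'f, 'v) pmod \<Rightarrow> 'r \<Rightarrow> 'v \<Rightarrow> 'v)
      \<Rightarrow> (('r, 'f, 'v) pmod, 'r \<Rightarrow> 'v \<Rightarrow> 'v, ('i, 'r) barcode, ('i \<times> 'i \<Rightarrow> 'f) set) func" where
  "bar_functor F R e bc \<theta> =
     \<lparr>FOb = bc,
      FArr = (\<lambda>U V \<phi>.
        let P = Pcat F R e;
            U' = interval_sum F e (bc U); V' = interval_sum F e (bc V);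
            \<phi>' = Cmp P U' V V' (\<theta> V) (Cmp P U' U V \<phi> (inverse_arrow P U U' (\<theta> U)))
        in THE x. \<exists>X\<in>matrices F (bc U) (bc V).
             computed_by F R e (bc U) (bc V) \<phi>' X \<and> x = matrix_class F (bc U) (bc V) X)\<rparr>"

end

(*
  The functor I is fully faithful: a natural transformation between sums of interval modules is
  determined by its components between single bars, naturality makes each component a constant
  scalar on the intersection of the two bars, and this scalar has to vanish unless b <= b' and
  d <= d', since otherwise one of the bars can be left, to the left or to the right, while staying
  in the other. A fully faithful functor H : D -> C together with a choice of isomorphisms
  theta U : U -> H (G U) makes G a quasi-inverse functor, with H (G f) = theta f theta^-1.
*)
theory Submission
  imports Defs
begin

section \<open>Fully faithful functors and equivalences\<close>

text \<open>What has to be controlled is the passage between matrices, their classes and morphisms.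
  At each \<open>t\<close> the product with a matrix is truncated to the bars alive at
  \<open>t\<close>, so three things need proof: the truncated product is natural, intermediate bars
  that are not alive at \<open>t\<close> do not disturb composition, and two matrices act alike
  exactly when \<open>matrix_rel\<close> identifies them. All three rest on one device: a strict
  inequality of cuts is witnessed by a point of \<open>R\<close>, so every zero condition on entries
  becomes a statement about single points. Once classes of matrices are identified with morphisms,
  one computation with matrix products yields both the well-definedness of composition of barcode
  arrows and the category laws, which are inherited from persistence modules. A sum of interval
  modules may come from several barcodes, so the composite on barcodes is the identity only up to
  isomorphism; its natural isomorphism has to be lifted through the interval functor from the
  inverse of \<theta>.\<close>

lemma (in category) inverse_arrow_inverse:
  assumes "A \<in> Ob C" "B \<in> Ob C" "iso_arrow C A B f"
  shows "inverse_arrows C A B f (inverse_arrow C A B f)"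
proof -
  obtain g where g: "inverse_arrows C A B f g"
    using assms(3) by (auto simp: iso_arrow_def)
  \<comment> \<open>The description operator in \<open>inverse_arrow\<close> needs uniqueness: h =
    (g f) h = g (f h) = g.\<close>
  have "h = g" if h: "inverse_arrows C A B f h" for h
  proof -
    have "h = Cmp C B A A (Cmp C A B A g f) h"
      using assms g h Cmp_Idn_left[of B A h] by (simp add: inverse_arrows_def)
    also have "\<dots> = Cmp C B B A g (Cmp C B A B f h)"
      using assms g h Cmp_assoc[of B A B A h f g] by (simp add: inverse_arrows_def)
    also have "\<dots> = g"
      using assms g h Cmp_Idn_right[of B A g] by (simp add: inverse_arrows_def)
    finally show ?thesis .
  qed
  with g show ?thesis
    unfolding inverse_arrow_def by (rule theI)
qed

lemma inverse_arrows_sym: "inverse_arrows C A B f g \<Longrightarrow> inverse_arrows C B A g f"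
  by (auto simp: inverse_arrows_def)

text \<open>The equation for \<open>FArr H\<close> of \<open>FArr G\<close> determines
  \<open>G\<close> on arrows because \<open>H\<close> is faithful. Functoriality of \<open>G\<close>
  is therefore a conclusion: both functor laws are checked after applying \<open>H\<close>, where
  they are identities about conjugation by \<theta>.\<close>

lemma equivalence_of_fully_faithful:
  assumes functor_H: "is_functor D C H"
    and fully_faithful: "\<And>A B f. \<lbrakk>A \<in> Ob D; B \<in> Ob D; f \<in> Hom C (FOb H A) (FOb H B)\<rbrakk>
      \<Longrightarrow> \<exists>!x. x \<in> Hom D A B \<and> FArr H A B x = f"
    and G_Ob: "\<And>U. U \<in> Ob C \<Longrightarrow> FOb G U \<in> Ob D"
    and iso: "\<And>U. U \<in> Ob C \<Longrightarrow> iso_arrow C U (FOb H (FOb G U)) (\<theta> U)"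
    and G_Hom: "\<And>U V f. \<lbrakk>U \<in> Ob C; V \<in> Ob C; f \<in> Hom C U V\<rbrakk>
      \<Longrightarrow> FArr G U V f \<in> Hom D (FOb G U) (FOb G V)"
    and G_arr: "\<And>U V f. \<lbrakk>U \<in> Ob C; V \<in> Ob C; f \<in> Hom C U V\<rbrakk>
      \<Longrightarrow> FArr H (FOb G U) (FOb G V) (FArr G U V f) =
        Cmp C (FOb H (FOb G U)) V (FOb H (FOb G V)) (\<theta> V)
          (Cmp C (FOb H (FOb G U)) U V f (inverse_arrow C U (FOb H (FOb G U)) (\<theta> U)))"
  shows "equivalence_of_categories C D G H"
proof -
  interpret H: is_functor D C H by (fact functor_H)
  define T where "T = (\<lambda>U. FOb H (FOb G U))"
  define j where "j = (\<lambda>U. inverse_arrow C U (T U) (\<theta> U))"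
  note cmp = H.target.Cmp_in_Hom and assoc = H.target.Cmp_assoc
    and idl = H.target.Cmp_Idn_left and idr = H.target.Cmp_Idn_right
  have T_Ob [simp]: "T U \<in> Ob C" if "U \<in> Ob C" for U
    using that G_Ob H.FOb_in_Ob by (simp add: T_def)
  have inv: "inverse_arrows C U (T U) (\<theta> U) (j U)" if "U \<in> Ob C" for U
    using that H.target.inverse_arrow_inverse[OF that T_Ob[OF that]] iso
    by (simp add: T_def j_def)
  have \<theta>_Hom [simp]: "\<theta> U \<in> Hom C U (T U)" and j_Hom [simp]: "j U \<in> Hom C (T U) U"
    and j\<theta>: "Cmp C U (T U) U (j U) (\<theta> U) = Idn C U"
    and \<theta>j: "Cmp C (T U) U (T U) (\<theta> U) (j U) = Idn C (T U)" if "U \<in> Ob C" for U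
    using inv[OF that] by (auto simp: inverse_arrows_def)
  have HG: "FArr H (FOb G U) (FOb G V) (FArr G U V f) =
      Cmp C (T U) V (T V) (\<theta> V) (Cmp C (T U) U V f (j U))"
    if "U \<in> Ob C" "V \<in> Ob C" "f \<in> Hom C U V" for U V f
    using G_arr[OF that] by (simp add: T_def j_def)
  \<comment> \<open>An inner pair j_V \<theta>_V is all that ever has to be removed: it appears in
    the composite of two conjugated arrows and in the naturality square of \<open>j\<close>.\<close>
  have cancel: "Cmp C A (T V) V (j V) (Cmp C A V (T V) (\<theta> V) f) = f"
    if "A \<in> Ob C" "V \<in> Ob C" "f \<in> Hom C A V" for A V f
    using that by (simp add: assoc[of A V "T V" V] j\<theta> idl)
  have eqI: "x = y" if "A \<in> Ob D" "B \<in> Ob D" "x \<in> Hom D A B" "y \<in> Hom D A B"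
    "FArr H A B x = FArr H A B y" for A B x y
    using fully_faithful[of A B "FArr H A B y"] that H.FArr_in_Hom by blast
  have functor_G: "is_functor C D G"
  proof
    fix U assume U: "U \<in> Ob C"
    have "FArr H (FOb G U) (FOb G U) (FArr G U U (Idn C U)) =
        FArr H (FOb G U) (FOb G U) (Idn D (FOb G U))"
      using U by (simp add: HG H.target.Idn_in_Hom idl[of "T U" U] \<theta>j H.FArr_Idn G_Ob)
        (simp add: T_def)
    then show "FArr G U U (Idn C U) = Idn D (FOb G U)"
      using U by (intro eqI[of "FOb G U" "FOb G U"])
        (auto simp: G_Ob G_Hom H.target.Idn_in_Hom H.source.Idn_in_Hom)
  next
    fix U V W f g
    assume *: "U \<in> Ob C" "V \<in> Ob C" "W \<in> Ob C" "f \<in> Hom C U V" "g \<in> Hom C V W"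
    let ?fj = "Cmp C (T U) U V f (j U)"
    have fj: "?fj \<in> Hom C (T U) V"
      using * by (simp add: cmp[of "T U" U V])
    \<comment> \<open>Under \<open>H\<close> the composite of the images is \<theta>_W g j_V
      \<theta>_V f j_U. Reassociating brings j_V next to \<theta>_V, where they cancel and leave g f
      conjugated by \<theta>.\<close>
    have "FArr H (FOb G U) (FOb G W)
        (Cmp D (FOb G U) (FOb G V) (FOb G W) (FArr G V W g) (FArr G U V f)) =
      Cmp C (T U) (T V) (T W) (Cmp C (T V) W (T W) (\<theta> W) (Cmp C (T V) V W g (j V)))
        (Cmp C (T U) V (T V) (\<theta> V) ?fj)"
      using * by (simp add: H.FArr_Cmp[of "FOb G U" "FOb G V" "FOb G W"] G_Ob G_Hom HG)
        (simp add: T_def)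
    also have "\<dots> = Cmp C (T U) W (T W) (\<theta> W) (Cmp C (T U) (T V) W
        (Cmp C (T V) V W g (j V)) (Cmp C (T U) V (T V) (\<theta> V) ?fj))"
      using * fj by (intro assoc[symmetric]) (auto intro!: cmp)
    also have "Cmp C (T U) (T V) W (Cmp C (T V) V W g (j V)) (Cmp C (T U) V (T V) (\<theta> V) ?fj)
        = Cmp C (T U) V W g (Cmp C (T U) (T V) V (j V) (Cmp C (T U) V (T V) (\<theta> V) ?fj))"
      using * fj by (intro assoc[symmetric]) (auto intro!: cmp[of "T U" V "T V"])
    also have "\<dots> = Cmp C (T U) V W g ?fj"
      using * fj by (simp add: cancel)
    also have "\<dots> = Cmp C (T U) U W (Cmp C U V W g f) (j U)"
      using * by (intro assoc) auto
    also have "Cmp C (T U) W (T W) (\<theta> W) \<dots> =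
        FArr H (FOb G U) (FOb G W) (FArr G U W (Cmp C U V W g f))"
      using * by (simp add: HG cmp[of U V W])
    finally show "FArr G U W (Cmp C U V W g f) =
        Cmp D (FOb G U) (FOb G V) (FOb G W) (FArr G V W g) (FArr G U V f)"
      using * by (intro eqI[of "FOb G U" "FOb G W"])
        (auto simp: G_Ob cmp[of U V W]
          intro!: G_Hom H.source.Cmp_in_Hom[of "FOb G U" "FOb G V" "FOb G W"])
  qed (use G_Ob G_Hom in auto)
  \<comment> \<open>This square is the naturality of \<open>j\<close>. It serves twice: directly for
    the isomorphism on \<open>C\<close>, and applied to the arrows \<open>FArr H A B f\<close> for
    the one on \<open>D\<close>.\<close>
  have HG_j: "Cmp C (T U) (T V) V (j V) (FArr H (FOb G U) (FOb G V) (FArr G U V f)) =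
      Cmp C (T U) U V f (j U)"
    if "U \<in> Ob C" "V \<in> Ob C" "f \<in> Hom C U V" for U V f
    using that by (simp add: HG cancel cmp[of "T U" U V])
  have "natural_iso C C (comp_func H G) id_func j"
    unfolding natural_iso_def
    using inv[THEN inverse_arrows_sym] HG_j
    by (auto simp: comp_func_def id_func_def iso_arrow_def T_def)
  moreover
  \<comment> \<open>The object G (H A) may differ from A, but \<open>H\<close> sends it to T (H A),
    which j (H A) maps isomorphically to H A. Fullness lifts this arrow to \<open>D\<close>,
    faithfulness makes the lift unique.\<close>
  define \<epsilon> where "\<epsilon> = (\<lambda>A. THE x. x \<in> Hom D (FOb G (FOb H A)) A \<and>
      FArr H (FOb G (FOb H A)) A x = j (FOb H A))"
  have GH: "FOb G (FOb H A) \<in> Ob D" if "A \<in> Ob D" for A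
    using that by (simp add: G_Ob H.FOb_in_Ob)
  have \<epsilon>: "\<epsilon> A \<in> Hom D (FOb G (FOb H A)) A"
    "FArr H (FOb G (FOb H A)) A (\<epsilon> A) = j (FOb H A)" if A: "A \<in> Ob D" for A
  proof -
    have "\<exists>!x. x \<in> Hom D (FOb G (FOb H A)) A \<and>
        FArr H (FOb G (FOb H A)) A x = j (FOb H A)"
      using j_Hom[of "FOb H A"] H.FOb_in_Ob[OF A]
      by (intro fully_faithful GH A) (simp add: T_def)
    from theI'[OF this] show "\<epsilon> A \<in> Hom D (FOb G (FOb H A)) A"
      "FArr H (FOb G (FOb H A)) A (\<epsilon> A) = j (FOb H A)" by (auto simp: \<epsilon>_def)
  qed
  have "natural_iso D D (comp_func G H) id_func \<epsilon>"
    unfolding natural_iso_def comp_func_def id_func_def func.simps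
  proof (intro conjI ballI)
    fix A assume A: "A \<in> Ob D"
    let ?A' = "FOb G (FOb H A)"
    have HA: "FOb H A \<in> Ob C" and A': "?A' \<in> Ob D"
      using A by (simp_all add: H.FOb_in_Ob GH)
    have TH: "FOb H ?A' = T (FOb H A)" by (simp add: T_def)
    \<comment> \<open>The inverse of \<epsilon>_A is the lift of \<theta> (H A); both composites are
      identities since their images under \<open>H\<close> are.\<close>
    obtain \<delta> where \<delta>: "\<delta> \<in> Hom D A ?A'" "FArr H A ?A' \<delta> = \<theta> (FOb H A)"
      using fully_faithful[OF A A', of "\<theta> (FOb H A)"] \<theta>_Hom[OF HA] by (auto simp: T_def)
    have "inverse_arrows D ?A' A (\<epsilon> A) \<delta>"
      unfolding inverse_arrows_def
    proof (intro conjI)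
      show "Cmp D ?A' A ?A' \<delta> (\<epsilon> A) = Idn D ?A'"
        using A A' \<delta> \<epsilon>[OF A] \<theta>j[OF HA]
        by (intro eqI[OF A' A'])
          (auto simp: H.source.Idn_in_Hom H.FArr_Idn H.FArr_Cmp TH
            intro: H.source.Cmp_in_Hom[of ?A' A ?A'])
      show "Cmp D A ?A' A (\<epsilon> A) \<delta> = Idn D A"
        using A A' \<delta> \<epsilon>[OF A] j\<theta>[OF HA]
        by (intro eqI[OF A A])
          (auto simp: H.source.Idn_in_Hom H.FArr_Idn H.FArr_Cmp TH
            intro: H.source.Cmp_in_Hom[of A ?A' A])
    qed (use \<delta> \<epsilon>[OF A] in auto)
    then show "iso_arrow D (FOb G (FOb H A)) A (\<epsilon> A)"
      by (auto simp: iso_arrow_def)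
  next
    fix A B f assume AB: "A \<in> Ob D" "B \<in> Ob D" and f: "f \<in> Hom D A B"
    let ?A' = "FOb G (FOb H A)" and ?B' = "FOb G (FOb H B)"
    let ?f' = "FArr G (FOb H A) (FOb H B) (FArr H A B f)"
    have Hf: "FArr H A B f \<in> Hom C (FOb H A) (FOb H B)"
      using AB f by (simp add: H.FArr_in_Hom)
    have f': "?f' \<in> Hom D ?A' ?B'"
      using AB Hf by (simp add: G_Hom H.FOb_in_Ob)
    have "FArr H ?A' B (Cmp D ?A' ?B' B (\<epsilon> B) ?f') = FArr H ?A' B (Cmp D ?A' A B f (\<epsilon> A))"
      using AB f f' \<epsilon> HG_j[OF _ _ Hf]
      by (simp add: H.FArr_Cmp[of ?A' ?B' B] H.FArr_Cmp[of ?A' A B] GH H.FOb_in_Ob T_def)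
    then show "Cmp D ?A' ?B' B (\<epsilon> B) ?f' = Cmp D ?A' A B f (\<epsilon> A)"
      using AB f f' \<epsilon> GH
      by (intro eqI[of ?A' B]) (auto intro: H.source.Cmp_in_Hom)
  qed
  ultimately show ?thesis
    using functor_G functor_H by (auto simp: equivalence_of_categories_def)
qed

section \<open>Categories of persistence modules\<close>

lemma category_full_subcategory:
  assumes "category C"
  shows "category (full_subcategory C P)"
proof -
  interpret category C by (fact assms)
  show ?thesis
    by unfold_locales
      (auto simp: full_subcategory_def Idn_in_Hom Cmp_Idn_left Cmp_Idn_right
        intro: Cmp_in_Hom Cmp_assoc)
qed

lemma linear_maps_id:
  assumes "module F V"
  shows "(\<lambda>x\<in>carrier V. x) \<in> linear_maps F V V"
proof -
  interpret module F V by (fact assms)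
  show ?thesis by (auto simp: linear_maps_def)
qed

lemma linear_mapsD:
  assumes "f \<in> linear_maps F V W"
  shows "f \<in> carrier V \<rightarrow>\<^sub>E carrier W"
    and "\<lbrakk>x \<in> carrier V; y \<in> carrier V\<rbrakk> \<Longrightarrow> f (x \<oplus>\<^bsub>V\<^esub> y) = f x \<oplus>\<^bsub>W\<^esub> f y"
    and "\<lbrakk>a \<in> carrier F; x \<in> carrier V\<rbrakk> \<Longrightarrow> f (a \<odot>\<^bsub>V\<^esub> x) = a \<odot>\<^bsub>W\<^esub> f x"
    and "x \<in> carrier V \<Longrightarrow> f x \<in> carrier W"
  using assms by (auto simp: linear_maps_def)

lemma linear_maps_compose:
  assumes "module F U" "f \<in> linear_maps F U V" "g \<in> linear_maps F V W"
  shows "compose (carrier U) g f \<in> linear_maps F U W"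
proof -
  interpret module F U by (fact assms)
  show ?thesis
    using linear_mapsD[OF assms(2)] linear_mapsD[OF assms(3)]
    by (auto simp: linear_maps_def compose_def)
qed

lemma linear_maps_mem:
  "f \<in> linear_maps F V W \<Longrightarrow> x \<in> carrier V \<Longrightarrow> f x \<in> carrier W"
  by (auto simp: linear_maps_def)

lemma pmod_morphismsD:
  assumes "\<phi> \<in> pmod_morphisms F R U V"
  shows "\<phi> \<in> extensional R"
    and "t \<in> R \<Longrightarrow> \<phi> t \<in> linear_maps F (Space U t) (Space V t)"
    and "\<lbrakk>s \<in> R; t \<in> R; s \<le> t; x \<in> carrier (Space U s)\<rbrakk>
      \<Longrightarrow> \<phi> t (Tr U s t x) = Tr V s t (\<phi> s x)"
proof -
  show "\<phi> \<in> extensional R" "t \<in> R \<Longrightarrow> \<phi> t \<in> linear_maps F (Space U t) (Space V t)"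
    using assms by (simp_all add: pmod_morphisms_def PiE_iff)
  assume *: "s \<in> R" "t \<in> R" "s \<le> t" "x \<in> carrier (Space U s)"
  then have "compose (carrier (Space U s)) (\<phi> t) (Tr U s t) x =
      compose (carrier (Space U s)) (Tr V s t) (\<phi> s) x"
    using assms by (simp add: pmod_morphisms_def)
  with * show "\<phi> t (Tr U s t x) = Tr V s t (\<phi> s x)"
    by (simp add: compose_def)
qed

lemma pmod_morphismsI:
  assumes "\<phi> \<in> extensional R"
    and "\<And>t. t \<in> R \<Longrightarrow> \<phi> t \<in> linear_maps F (Space U t) (Space V t)"
    and "\<And>s t x. \<lbrakk>s \<in> R; t \<in> R; s \<le> t; x \<in> carrier (Space U s)\<rbrakk>
      \<Longrightarrow> \<phi> t (Tr U s t x) = Tr V s t (\<phi> s x)"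
  shows "\<phi> \<in> pmod_morphisms F R U V"
proof -
  have "\<phi> \<in> (\<Pi>\<^sub>E t\<in>R. linear_maps F (Space U t) (Space V t))"
    using assms(1,2) by (simp add: PiE_iff)
  moreover have "compose (carrier (Space U s)) (\<phi> t) (Tr U s t) =
      compose (carrier (Space U s)) (Tr V s t) (\<phi> s)" if "s \<in> R" "t \<in> R" "s \<le> t" for s t
    unfolding compose_def by (rule restrict_ext) (rule assms(3)[OF that])
  ultimately show ?thesis by (simp add: pmod_morphisms_def)
qed

lemma pmod_morphisms_eqI:
  assumes "\<phi> \<in> pmod_morphisms F R U V" "\<psi> \<in> pmod_morphisms F R U V"
    and "\<And>t x. \<lbrakk>t \<in> R; x \<in> carrier (Space U t)\<rbrakk> \<Longrightarrow> \<phi> t x = \<psi> t x"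
  shows "\<phi> = \<psi>"
proof (rule extensionalityI[of \<phi> R \<psi>])
  fix t assume t: "t \<in> R"
  have "\<phi> t \<in> carrier (Space U t) \<rightarrow>\<^sub>E carrier (Space V t)"
    "\<psi> t \<in> carrier (Space U t) \<rightarrow>\<^sub>E carrier (Space V t)"
    using assms(1,2) t by (auto dest: pmod_morphismsD(2) linear_mapsD(1))
  then show "\<phi> t = \<psi> t"
    by (rule PiE_ext) (use assms(3) t in auto)
qed (use assms in \<open>auto dest: pmod_morphismsD(1)\<close>)

lemma persistence_moduleD:
  assumes "persistence_module F R V"
  shows "t \<in> R \<Longrightarrow> module F (Space V t)"
    and "\<lbrakk>s \<in> R; t \<in> R; s \<le> t\<rbrakk> \<Longrightarrow> Tr V s t \<in> linear_maps F (Space V s) (Space V t)"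
proof -
  have *: "\<forall>t\<in>R. module F (Space V t)"
    "\<forall>s\<in>R. \<forall>t\<in>R. s \<le> t \<longrightarrow> Tr V s t \<in> linear_maps F (Space V s) (Space V t)"
    using assms unfolding persistence_module_def by - (elim conjE, assumption)+
  show "t \<in> R \<Longrightarrow> module F (Space V t)"
    "\<lbrakk>s \<in> R; t \<in> R; s \<le> t\<rbrakk> \<Longrightarrow> Tr V s t \<in> linear_maps F (Space V s) (Space V t)"
    using * by blast+
qed

lemmas persistence_module_Tr = linear_maps_mem[OF persistence_moduleD(2)]

lemma pmod_category_simps:
  "Ob (pmod_category F R) = {V. persistence_module F R V}"
  "Hom (pmod_category F R) = pmod_morphisms F R"
  "Idn (pmod_category F R) V = (\<lambda>t\<in>R. \<lambda>x\<in>carrier (Space V t). x)"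
  "Cmp (pmod_category F R) U V W \<psi> \<phi> = (\<lambda>t\<in>R. compose (carrier (Space U t)) (\<psi> t) (\<phi> t))"
  by (simp_all add: pmod_category_def)

lemma category_pmod:
  fixes F :: "'f ring" and R :: "'r::linorder set"
  shows "category (pmod_category F R :: (('r, 'f, 'v) pmod, 'r \<Rightarrow> 'v \<Rightarrow> 'v) cat)"
proof (unfold_locales, unfold pmod_category_simps mem_Collect_eq)
  fix V :: "('r, 'f, 'v) pmod" assume "persistence_module F R V"
  then show "(\<lambda>t\<in>R. \<lambda>x\<in>carrier (Space V t). x) \<in> pmod_morphisms F R V V"
    by (intro pmod_morphismsI)
      (simp_all add: persistence_module_Tr linear_maps_id persistence_moduleD(1))
next
  fix U V W :: "('r, 'f, 'v) pmod" and \<phi> \<psi>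
  assume U: "persistence_module F R U" and "persistence_module F R V" "persistence_module F R W"
    and \<phi>: "\<phi> \<in> pmod_morphisms F R U V" and \<psi>: "\<psi> \<in> pmod_morphisms F R V W"
  note \<phi>D = pmod_morphismsD[OF \<phi>] and \<psi>D = pmod_morphismsD[OF \<psi>]
  show "(\<lambda>t\<in>R. compose (carrier (Space U t)) (\<psi> t) (\<phi> t)) \<in> pmod_morphisms F R U W"
  proof (rule pmod_morphismsI)
    fix t assume "t \<in> R"
    then show "(\<lambda>t\<in>R. compose (carrier (Space U t)) (\<psi> t) (\<phi> t)) t
        \<in> linear_maps F (Space U t) (Space W t)"
      using linear_maps_compose[OF persistence_moduleD(1)[OF U] \<phi>D(2) \<psi>D(2)] by simp
  next
    fix s t x assume *: "s \<in> R" "t \<in> R" "s \<le> t" "x \<in> carrier (Space U s)"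
    then show "(\<lambda>t\<in>R. compose (carrier (Space U t)) (\<psi> t) (\<phi> t)) t (Tr U s t x) =
        Tr W s t ((\<lambda>t\<in>R. compose (carrier (Space U t)) (\<psi> t) (\<phi> t)) s x)"
      using persistence_module_Tr[OF U *] linear_maps_mem[OF \<phi>D(2)]
      by (simp add: compose_eq \<phi>D(3) \<psi>D(3))
  qed auto
next
  fix U V :: "('r, 'f, 'v) pmod" and \<phi>
  assume *: "persistence_module F R U" "persistence_module F R V" "\<phi> \<in> pmod_morphisms F R U V"
  note D = pmod_morphismsD[OF *(3)]
  have "compose (carrier (Space U t)) (\<lambda>x\<in>carrier (Space V t). x) (\<phi> t) = \<phi> t"
    "compose (carrier (Space U t)) (\<phi> t) (\<lambda>x\<in>carrier (Space U t). x) = \<phi> t" if "t \<in> R" for t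
    using linear_mapsD(1)[OF D(2)[OF that]]
    by (auto simp: PiE_iff intro!: Id_compose compose_Id)
  with D(1) show
    "(\<lambda>t\<in>R. compose (carrier (Space U t)) ((\<lambda>t\<in>R. \<lambda>x\<in>carrier (Space V t). x) t) (\<phi> t)) = \<phi>"
    "(\<lambda>t\<in>R. compose (carrier (Space U t)) (\<phi> t) ((\<lambda>t\<in>R. \<lambda>x\<in>carrier (Space U t). x) t)) = \<phi>"
    by (auto intro!: extensionalityI[of _ R])
next
  fix U V W X :: "('r, 'f, 'v) pmod" and \<phi> \<psi> \<chi> :: "'r \<Rightarrow> 'v \<Rightarrow> 'v"
  assume "\<phi> \<in> pmod_morphisms F R U V"
  then have *: "\<phi> t \<in> carrier (Space U t) \<rightarrow> carrier (Space V t)" if "t \<in> R" for t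
    using that by (auto dest: pmod_morphismsD(2) linear_maps_mem)
  show "(\<lambda>t\<in>R. compose (carrier (Space U t)) (\<chi> t)
        ((\<lambda>t\<in>R. compose (carrier (Space U t)) (\<psi> t) (\<phi> t)) t)) =
      (\<lambda>t\<in>R. compose (carrier (Space U t))
        ((\<lambda>t\<in>R. compose (carrier (Space V t)) (\<chi> t) (\<psi> t)) t) (\<phi> t))"
    by (rule restrict_ext) (simp add: compose_assoc[OF *])
qed

lemma category_Pcat: "category (Pcat F R e)"
  by (simp add: Pcat_def category_full_subcategory category_pmod)

section \<open>Cuts and sums of interval modules\<close>


text \<open>A point in both halves would be smaller than itself, so the halves are complementary.
  This lets cuts and bars be handled through lower parts alone.\<close>

lemma mem_upper_part_iff:
  assumes "c \<in> cuts R" "t \<in> R"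
  shows "t \<in> upper_part c \<longleftrightarrow> t \<notin> lower_part c"
  using assms unfolding cuts_def by blast

lemma lower_part_downward:
  assumes "c \<in> cuts R" "t \<in> lower_part c" "s \<in> R" "s \<le> t"
  shows "s \<in> lower_part c"
  using assms unfolding cuts_def by (auto simp: not_le[symmetric])

text \<open>Lower parts are down-closed, hence nested, and each determines its cut. A strict
  inequality of cuts is thus the same as a single point of \<open>R\<close> lying above one cut and
  below the other, which is the form that can be compared with membership in bars.\<close>

lemma cut_less_iff:
  assumes "c \<in> cuts R" "d \<in> cuts R"
  shows "cut_less c d \<longleftrightarrow> (\<exists>t\<in>R. t \<notin> lower_part c \<and> t \<in> lower_part d)"
proof
  assume less: "cut_less c d"
  have "lower_part c \<noteq> lower_part d"
  proof
    assume eq: "lower_part c = lower_part d"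
    have "upper_part c = R - lower_part c" "upper_part d = R - lower_part d"
      using assms by (auto simp: cuts_def)
    with eq less show False
      by (auto simp: cut_less_def prod_eq_iff)
  qed
  with less assms show "\<exists>t\<in>R. t \<notin> lower_part c \<and> t \<in> lower_part d"
    by (auto simp: cut_less_def cut_le_def cuts_def)
next
  assume "\<exists>t\<in>R. t \<notin> lower_part c \<and> t \<in> lower_part d"
  then obtain t where t: "t \<in> R" "t \<notin> lower_part c" "t \<in> lower_part d" by blast
  \<comment> \<open>The separating point belongs to the upper part of \<open>c\<close>, so it bounds
    the lower part of \<open>c\<close>; down-closure of the lower part of \<open>d\<close> then
    gives the inclusion.\<close>
  have "s \<le> t" if "s \<in> lower_part c" for s
    using that t assms(1) mem_upper_part_iff[OF assms(1) t(1)] by (force simp: cuts_def)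
  with t assms show "cut_less c d"
    using lower_part_downward[OF assms(2) t(3)]
    by (auto simp: cut_less_def cut_le_def cuts_def)
qed

abbreviation bar :: "('i, 'r) barcode \<Rightarrow> 'i \<Rightarrow> 'r set" where
  "bar \<beta> i \<equiv> cut_interval (birth \<beta> i) (death \<beta> i)"

lemma barcodesD:
  assumes "\<beta> \<in> barcodes R"
  shows "finite (dom \<beta>)" "i \<in> dom \<beta> \<Longrightarrow> birth \<beta> i \<in> cuts R" "i \<in> dom \<beta> \<Longrightarrow> death \<beta> i \<in> cuts R"
  using assms by (auto simp: barcodes_def)

lemma mem_bar_iff:
  assumes "\<beta> \<in> barcodes R" "i \<in> dom \<beta>" "t \<in> R"
  shows "t \<in> bar \<beta> i \<longleftrightarrow> t \<notin> lower_part (birth \<beta> i) \<and> t \<in> lower_part (death \<beta> i)"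
  using mem_upper_part_iff[OF barcodesD(2)[OF assms(1,2)] assms(3)] by (simp add: cut_interval_def)

text \<open>With witnesses in place of cut inequalities, the vanishing of an entry follows from the
  position of one point relative to the two bars, usually the point at which a vector is
  evaluated.\<close>

lemma matrices_iff:
  assumes "\<beta>' \<in> barcodes R" "\<beta> \<in> barcodes R"
  shows "X \<in> matrices F \<beta>' \<beta> \<longleftrightarrow> X \<in> (dom \<beta> \<times> dom \<beta>') \<rightarrow>\<^sub>E carrier F \<and>
    (\<forall>i\<in>dom \<beta>. \<forall>j\<in>dom \<beta>'. \<forall>t\<in>R.
      t \<notin> lower_part (birth \<beta>' j) \<and> t \<in> lower_part (birth \<beta> i) \<or>
      t \<notin> lower_part (death \<beta>' j) \<and> t \<in> lower_part (death \<beta> i) \<longrightarrow> X (i, j) = \<zero>\<^bsub>F\<^esub>)"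
proof -
  have "cut_less (birth \<beta>' j) (birth \<beta> i) \<longleftrightarrow>
      (\<exists>t\<in>R. t \<notin> lower_part (birth \<beta>' j) \<and> t \<in> lower_part (birth \<beta> i))"
    "cut_less (death \<beta>' j) (death \<beta> i) \<longleftrightarrow>
      (\<exists>t\<in>R. t \<notin> lower_part (death \<beta>' j) \<and> t \<in> lower_part (death \<beta> i))"
    if "i \<in> dom \<beta>" "j \<in> dom \<beta>'" for i j
    using that assms by - (intro cut_less_iff barcodesD; assumption)+
  then show ?thesis
    by (simp add: matrices_def cong: ball_cong) blast
qed

lemma matrices_zero:
  assumes "X \<in> matrices F \<beta>' \<beta>" "\<beta>' \<in> barcodes R" "\<beta> \<in> barcodes R"
    and "i \<in> dom \<beta>" "j \<in> dom \<beta>'" "t \<in> R"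
    and "t \<notin> lower_part (birth \<beta>' j) \<and> t \<in> lower_part (birth \<beta> i) \<or>
      t \<notin> lower_part (death \<beta>' j) \<and> t \<in> lower_part (death \<beta> i)"
  shows "X (i, j) = \<zero>\<^bsub>F\<^esub>"
  using assms matrices_iff[OF assms(2,3), of X F] by blast

lemma matrices_closed:
  "\<lbrakk>X \<in> matrices F \<beta>' \<beta>; i \<in> dom \<beta>; j \<in> dom \<beta>'\<rbrakk> \<Longrightarrow> X (i, j) \<in> carrier F"
  unfolding matrices_def by (auto dest: PiE_mem)

lemma matrix_rel_iff:
  assumes "\<beta>' \<in> barcodes R" "\<beta> \<in> barcodes R"
  shows "(X, Y) \<in> matrix_rel F \<beta>' \<beta> \<longleftrightarrow> X \<in> matrices F \<beta>' \<beta> \<and> Y \<in> matrices F \<beta>' \<beta> \<and>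
    (\<forall>i\<in>dom \<beta>. \<forall>j\<in>dom \<beta>'. \<forall>t\<in>R.
      t \<notin> lower_part (birth \<beta>' j) \<and> t \<in> lower_part (death \<beta> i) \<longrightarrow> X (i, j) = Y (i, j))"
proof -
  have "cut_less (birth \<beta>' j) (death \<beta> i) \<longleftrightarrow>
      (\<exists>t\<in>R. t \<notin> lower_part (birth \<beta>' j) \<and> t \<in> lower_part (death \<beta> i))"
    if "i \<in> dom \<beta>" "j \<in> dom \<beta>'" for i j
    using that assms by (intro cut_less_iff barcodesD)
  then show ?thesis
    by (simp add: matrix_rel_def cong: ball_cong)
qed

lemma equiv_matrix_rel: "equiv (matrices F \<beta>' \<beta>) (matrix_rel F \<beta>' \<beta>)"
  by (rule equivI) (auto simp: matrix_rel_def refl_on_def sym_def trans_def)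

declare domIff [iff del]

section \<open>Coordinates on sums of interval modules\<close>

locale interval_sums = cring F for F :: "'f ring" (structure) +
  fixes R :: "'r::linorder set" and e :: "('i \<Rightarrow> 'f) \<Rightarrow> 'v"
  assumes inj_e: "inj e"
begin

lemma the_inv_e [simp]: "the_inv e (e x) = x"
  by (rule the_inv_f_f[OF inj_e])

lemma e_eq_iff [simp]: "e x = e y \<longleftrightarrow> x = y"
  using inj_e by (rule inj_eq)

abbreviation isum :: "('i, 'r) barcode \<Rightarrow> ('r, 'f, 'v) pmod" where
  "isum \<equiv> interval_sum F e"

text \<open>These families are the canonical representatives of the classes of vectors at
  \<open>t\<close>: coordinates past their death, which a class leaves open, are fixed to
  zero.\<close>

definition coords :: "('i, 'r) barcode \<Rightarrow> 'r \<Rightarrow> ('i \<Rightarrow> 'f) set" where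
  "coords \<beta> t = {x \<in> dom \<beta> \<rightarrow>\<^sub>E carrier F. \<forall>i\<in>dom \<beta>. t \<notin> bar \<beta> i \<longrightarrow> x i = \<zero>}"

lemma coords_zero: "\<lbrakk>x \<in> coords \<beta> t; i \<in> dom \<beta>; t \<notin> bar \<beta> i\<rbrakk> \<Longrightarrow> x i = \<zero>"
  by (auto simp: coords_def)

lemma coords_closed: "\<lbrakk>x \<in> coords \<beta> t; i \<in> dom \<beta>\<rbrakk> \<Longrightarrow> x i \<in> carrier F"
  by (auto simp: coords_def)

lemma coordsI:
  assumes "\<And>i. i \<in> dom \<beta> \<Longrightarrow> x i \<in> carrier F"
    and "\<And>i. \<lbrakk>i \<in> dom \<beta>; t \<notin> bar \<beta> i\<rbrakk> \<Longrightarrow> x i = \<zero>"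
  shows "restrict x (dom \<beta>) \<in> coords \<beta> t"
  using assms by (auto simp: coords_def)

lemma coords_restrict: "x \<in> coords \<beta> t \<Longrightarrow> restrict x (dom \<beta>) = x"
  by (auto simp: coords_def intro: PiE_restrict)

lemma coords_ext:
  assumes "x \<in> coords \<beta> t" "y \<in> coords \<beta> t" "\<And>i. i \<in> dom \<beta> \<Longrightarrow> x i = y i"
  shows "x = y"
  using assms by (auto simp: coords_def intro: PiE_ext)

lemma PiE_eq_coords:
  "(\<Pi>\<^sub>E i\<in>dom \<beta>. if t \<in> bar \<beta> i then carrier F else {\<zero>}) = coords \<beta> t"
proof (rule Set.set_eqI)
  fix x
  have "(\<forall>i\<in>dom \<beta>. x i \<in> (if t \<in> bar \<beta> i then carrier F else {\<zero>})) \<longleftrightarrow>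
      (\<forall>i\<in>dom \<beta>. x i \<in> carrier F \<and> (t \<notin> bar \<beta> i \<longrightarrow> x i = \<zero>))"
    by (rule ball_cong) auto
  then show "x \<in> (\<Pi>\<^sub>E i\<in>dom \<beta>. if t \<in> bar \<beta> i then carrier F else {\<zero>}) \<longleftrightarrow> x \<in> coords \<beta> t"
    unfolding coords_def PiE_iff mem_Collect_eq by blast
qed

lemma carrier_isum: "carrier (Space (isum \<beta>) t) = e ` coords \<beta> t"
  by (simp add: interval_sum_def pmod_transport_def pmod_direct_sum_def interval_module_def
      Let_def PiE_eq_coords)

lemma isum_simps:
  "\<zero>\<^bsub>Space (isum \<beta>) t\<^esub> = e (\<lambda>i\<in>dom \<beta>. \<zero>)"
  "e x \<oplus>\<^bsub>Space (isum \<beta>) t\<^esub> e y = e (\<lambda>i\<in>dom \<beta>. x i \<oplus> y i)"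
  "a \<odot>\<^bsub>Space (isum \<beta>) t\<^esub> e x = e (\<lambda>i\<in>dom \<beta>. a \<otimes> x i)"
  by (simp_all add: interval_sum_def pmod_transport_def pmod_direct_sum_def interval_module_def
      Let_def)

lemma Tr_isum:
  "Tr (isum \<beta>) s t = (\<lambda>y\<in>e ` coords \<beta> s. e (\<lambda>i\<in>dom \<beta>.
    if s \<in> bar \<beta> i \<and> t \<in> bar \<beta> i then the_inv e y i else \<zero>))"
proof -
  have "Tr (isum \<beta>) s t = (\<lambda>y\<in>e ` coords \<beta> s.
    e ((\<lambda>x\<in>coords \<beta> s. \<lambda>i\<in>dom \<beta>.
      (\<lambda>x\<in>if s \<in> bar \<beta> i then carrier F else {\<zero>}.
        if s \<in> bar \<beta> i \<and> t \<in> bar \<beta> i then x else \<zero>) (x i)) (the_inv e y)))"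
    by (simp add: interval_sum_def pmod_transport_def pmod_direct_sum_def interval_module_def
        Let_def PiE_eq_coords)
  \<comment> \<open>The coordinates of an element of \<open>coords \<beta> s\<close> already lie in
    the carriers of their interval modules, so the inner restrictions have no effect.\<close>
  also have "\<dots> = (\<lambda>y\<in>e ` coords \<beta> s. e (\<lambda>i\<in>dom \<beta>.
    if s \<in> bar \<beta> i \<and> t \<in> bar \<beta> i then the_inv e y i else \<zero>))"
    by (auto intro!: restrict_ext simp: coords_closed coords_zero)
  finally show ?thesis .
qed

lemma Tr_isum_e:
  "x \<in> coords \<beta> s \<Longrightarrow> Tr (isum \<beta>) s t (e x) =
    e (\<lambda>i\<in>dom \<beta>. if s \<in> bar \<beta> i \<and> t \<in> bar \<beta> i then x i else \<zero>)"
  by (simp add: Tr_isum cong: if_cong)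

lemma module_isum: "module F (Space (isum \<beta>) t)"
proof (rule moduleI)
  show "cring F" by (fact cring_axioms)
  show "abelian_group (Space (isum \<beta>) t)"
  proof (rule abelian_groupI, unfold carrier_isum)
    fix x assume "x \<in> e ` coords \<beta> t"
    then obtain u where u: "x = e u" "u \<in> coords \<beta> t" by blast
    have "e (\<lambda>i\<in>dom \<beta>. \<ominus> u i) \<in> e ` coords \<beta> t"
      using u by (auto intro!: coordsI simp: coords_closed coords_zero)
    moreover have "e (\<lambda>i\<in>dom \<beta>. \<ominus> u i) \<oplus>\<^bsub>Space (isum \<beta>) t\<^esub> x = \<zero>\<^bsub>Space (isum \<beta>) t\<^esub>"
      using u by (auto simp: isum_simps coords_closed l_neg intro!: restrict_ext)
    ultimately show "\<exists>y\<in>e ` coords \<beta> t. y \<oplus>\<^bsub>Space (isum \<beta>) t\<^esub> x = \<zero>\<^bsub>Space (isum \<beta>) t\<^esub>"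
      by blast
  next
    fix x assume "x \<in> e ` coords \<beta> t"
    then obtain u where u: "x = e u" "u \<in> coords \<beta> t" by blast
    have "restrict (\<lambda>i. \<zero> \<oplus> u i) (dom \<beta>) = restrict u (dom \<beta>)"
      by (rule restrict_ext) (use u in \<open>simp add: coords_closed\<close>)
    then show "\<zero>\<^bsub>Space (isum \<beta>) t\<^esub> \<oplus>\<^bsub>Space (isum \<beta>) t\<^esub> x = x"
      using u by (simp add: isum_simps coords_restrict cong: restrict_cong)
  qed (auto simp: isum_simps coords_closed coords_zero a_ac
      intro!: coordsI imageI restrict_ext)
next
  fix x assume "x \<in> carrier (Space (isum \<beta>) t)"
  then obtain u where u: "x = e u" "u \<in> coords \<beta> t" by (auto simp: carrier_isum)
  have "restrict (\<lambda>i. \<one> \<otimes> u i) (dom \<beta>) = restrict u (dom \<beta>)"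
    by (rule restrict_ext) (use u in \<open>simp add: coords_closed\<close>)
  then show "\<one> \<odot>\<^bsub>Space (isum \<beta>) t\<^esub> x = x"
    using u by (simp add: isum_simps coords_restrict)
qed (auto simp: carrier_isum isum_simps coords_closed coords_zero l_distr r_distr m_assoc
      intro!: coordsI restrict_ext imageI)

lemma coords_add:
  "\<lbrakk>x \<in> coords \<beta> t; y \<in> coords \<beta> t\<rbrakk> \<Longrightarrow> (\<lambda>i\<in>dom \<beta>. x i \<oplus> y i) \<in> coords \<beta> t"
  by (rule coordsI) (simp_all add: coords_closed coords_zero)

lemma coords_smult:
  "\<lbrakk>a \<in> carrier F; x \<in> coords \<beta> t\<rbrakk> \<Longrightarrow> (\<lambda>i\<in>dom \<beta>. a \<otimes> x i) \<in> coords \<beta> t"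
  by (rule coordsI) (simp_all add: coords_closed coords_zero)

lemma coords_Tr:
  "x \<in> coords \<beta> s \<Longrightarrow> (\<lambda>i\<in>dom \<beta>. if s \<in> bar \<beta> i \<and> t \<in> bar \<beta> i then x i else \<zero>) \<in> coords \<beta> t"
  by (rule coordsI) (simp_all add: coords_closed)

lemma linear_maps_isumI:
  assumes "\<And>x. x \<in> coords \<beta>' s \<Longrightarrow> g x \<in> coords \<beta> t"
    and "\<And>x y. \<lbrakk>x \<in> coords \<beta>' s; y \<in> coords \<beta>' s\<rbrakk>
      \<Longrightarrow> g (\<lambda>j\<in>dom \<beta>'. x j \<oplus> y j) = (\<lambda>i\<in>dom \<beta>. g x i \<oplus> g y i)"
    and "\<And>a x. \<lbrakk>a \<in> carrier F; x \<in> coords \<beta>' s\<rbrakk>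
      \<Longrightarrow> g (\<lambda>j\<in>dom \<beta>'. a \<otimes> x j) = (\<lambda>i\<in>dom \<beta>. a \<otimes> g x i)"
  shows "(\<lambda>y\<in>e ` coords \<beta>' s. e (g (the_inv e y)))
    \<in> linear_maps F (Space (isum \<beta>') s) (Space (isum \<beta>) t)"
  unfolding linear_maps_def carrier_isum mem_Collect_eq
proof (intro conjI ballI)
  show "(\<lambda>y\<in>e ` coords \<beta>' s. e (g (the_inv e y))) \<in> e ` coords \<beta>' s \<rightarrow>\<^sub>E e ` coords \<beta> t"
    using assms(1) by auto
qed (auto simp: isum_simps coords_add coords_smult assms(2,3))

text \<open>Convexity is what makes transition maps compose: a coordinate that is kept from
  \<open>s\<close> to \<open>u\<close> must not be erased at an intermediate
  \<open>t\<close>.\<close>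

lemma bar_convex:
  assumes "\<beta> \<in> barcodes R" "i \<in> dom \<beta>" "s \<in> R" "t \<in> R" "u \<in> R" "s \<le> t" "t \<le> u"
    and "s \<in> bar \<beta> i" "u \<in> bar \<beta> i"
  shows "t \<in> bar \<beta> i"
  using assms lower_part_downward[OF barcodesD(2)[OF assms(1,2)], of t s]
    lower_part_downward[OF barcodesD(3)[OF assms(1,2)], of u t]
  by (auto simp: mem_bar_iff)

lemma persistence_module_isum:
  assumes \<beta>: "\<beta> \<in> barcodes R"
  shows "persistence_module F R (isum \<beta>)"
  unfolding persistence_module_def
proof (intro conjI ballI impI)
  fix s t show "Tr (isum \<beta>) s t \<in> linear_maps F (Space (isum \<beta>) s) (Space (isum \<beta>) t)"
    unfolding Tr_isum
    by (rule linear_maps_isumI[where g = "\<lambda>x. \<lambda>i\<in>dom \<beta>.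
      if s \<in> bar \<beta> i \<and> t \<in> bar \<beta> i then x i else \<zero>"], erule coords_Tr)
      (rule restrict_ext, simp)+
next
  fix t
  have "(\<lambda>i\<in>dom \<beta>. if t \<in> bar \<beta> i \<and> t \<in> bar \<beta> i then x i else \<zero>) = x" if "x \<in> coords \<beta> t" for x
    by (rule coords_ext[OF coords_Tr[OF that] that]) (use that in \<open>simp add: coords_zero\<close>)
  then show "Tr (isum \<beta>) t t = (\<lambda>x\<in>carrier (Space (isum \<beta>) t). x)"
    unfolding carrier_isum Tr_isum by (intro restrict_ext) (auto simp del: restrict_apply)
next
  fix s t u assume *: "s \<in> R" "t \<in> R" "u \<in> R" "s \<le> t" "t \<le> u"
  show "Tr (isum \<beta>) s u =
      compose (carrier (Space (isum \<beta>) s)) (Tr (isum \<beta>) t u) (Tr (isum \<beta>) s t)"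
    unfolding compose_def carrier_isum
  proof (subst Tr_isum, rule restrict_ext, erule imageE)
    fix y x assume y: "y = e x" and x: "x \<in> coords \<beta> s"
    show "e (\<lambda>i\<in>dom \<beta>. if s \<in> bar \<beta> i \<and> u \<in> bar \<beta> i then the_inv e y i else \<zero>) =
        Tr (isum \<beta>) t u (Tr (isum \<beta>) s t y)"
      unfolding y Tr_isum_e[OF x] Tr_isum_e[OF coords_Tr[OF x]] e_eq_iff the_inv_e
      using bar_convex[OF \<beta> _ *] by (intro restrict_ext) auto
  qed
qed (rule module_isum)

lemma isum_in_Pcat:
  assumes "\<beta> \<in> barcodes R"
  shows "isum \<beta> \<in> Ob (Pcat F R e)"
proof -
  interpret category "pmod_category F R :: (('r, 'f, 'v) pmod, 'r \<Rightarrow> 'v \<Rightarrow> 'v) cat"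
    by (fact category_pmod)
  have Ob: "isum \<beta> \<in> Ob (pmod_category F R)"
    using persistence_module_isum[OF assms] by (simp add: pmod_category_simps)
  then have "inverse_arrows (pmod_category F R) (isum \<beta>) (isum \<beta>)
      (Idn (pmod_category F R) (isum \<beta>)) (Idn (pmod_category F R) (isum \<beta>))"
    by (simp add: inverse_arrows_def Idn_in_Hom Cmp_Idn_left)
  then have "finite_type F R e (isum \<beta>)"
    using assms by (auto simp: finite_type_def isomorphic_objects_def iso_arrow_def)
  with Ob show ?thesis
    by (simp add: Pcat_def full_subcategory_def)
qed

end

section \<open>Morphisms computed by matrices\<close>

context abelian_monoid
begin

lemma finsum_swap:
  assumes "finite A" "finite B" "\<And>a b. \<lbrakk>a \<in> A; b \<in> B\<rbrakk> \<Longrightarrow> f a b \<in> carrier G"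
  shows "(\<Oplus>a\<in>A. \<Oplus>b\<in>B. f a b) = (\<Oplus>b\<in>B. \<Oplus>a\<in>A. f a b)"
  using assms(1,3)
proof (induction A rule: finite_induct)
  case empty
  show ?case by simp
next
  case (insert a A)
  have "(\<Oplus>b\<in>B. \<Oplus>a\<in>insert a A. f a b) = (\<Oplus>b\<in>B. f a b \<oplus> (\<Oplus>a\<in>A. f a b))"
    using insert by (intro finsum_cong') (auto intro!: finsum_insert finsum_closed)
  also have "\<dots> = (\<Oplus>b\<in>B. f a b) \<oplus> (\<Oplus>b\<in>B. \<Oplus>a\<in>A. f a b)"
    using insert by (intro finsum_addf) (auto intro!: finsum_closed)
  also have "\<dots> = (\<Oplus>a\<in>insert a A. \<Oplus>b\<in>B. f a b)"
    using insert by (subst finsum_insert) (auto intro!: finsum_closed)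
  finally show ?case by simp
qed

lemma finsum_single:
  assumes "finite A" "k \<in> A" "\<And>a. \<lbrakk>a \<in> A; a \<noteq> k\<rbrakk> \<Longrightarrow> f a = \<zero>" "f k \<in> carrier G"
  shows "(\<Oplus>a\<in>A. f a) = f k"
proof -
  have "(\<Oplus>a\<in>A. f a) = (\<Oplus>a\<in>A. if k = a then f k else \<zero>)"
    using assms by (intro finsum_cong') auto
  then show ?thesis
    using add.finprod_singleton[of k A "\<lambda>_. f k"] assms by simp
qed

end

context interval_sums
begin

text \<open>The plain product can be nonzero in a row whose bar has already died at
  \<open>t\<close>; truncation returns it to the canonical representative of its class.\<close>

definition mat_act ::
    "('i, 'r) barcode \<Rightarrow> ('i, 'r) barcode \<Rightarrow> ('i \<times> 'i \<Rightarrow> 'f) \<Rightarrow> 'r \<Rightarrow> ('i \<Rightarrow> 'f) \<Rightarrow> 'i \<Rightarrow> 'f" where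
  "mat_act \<beta>' \<beta> X t x =
     (\<lambda>i\<in>dom \<beta>. if t \<in> bar \<beta> i then \<Oplus>j\<in>dom \<beta>'. X (i, j) \<otimes> x j else \<zero>)"

definition mat_mor ::
    "('i, 'r) barcode \<Rightarrow> ('i, 'r) barcode \<Rightarrow> ('i \<times> 'i \<Rightarrow> 'f) \<Rightarrow> 'r \<Rightarrow> 'v \<Rightarrow> 'v" where
  "mat_mor \<beta>' \<beta> X = (\<lambda>t\<in>R. \<lambda>y\<in>e ` coords \<beta>' t. e (mat_act \<beta>' \<beta> X t (the_inv e y)))"

lemma mat_mor_e:
  "\<lbrakk>t \<in> R; x \<in> coords \<beta>' t\<rbrakk> \<Longrightarrow> mat_mor \<beta>' \<beta> X t (e x) = e (mat_act \<beta>' \<beta> X t x)"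
  by (simp add: mat_mor_def)

lemma mat_act_in_coords:
  assumes "X \<in> matrices F \<beta>' \<beta>" "x \<in> coords \<beta>' s"
  shows "mat_act \<beta>' \<beta> X t x \<in> coords \<beta> t"
  unfolding mat_act_def
  using assms by (intro coordsI) (auto intro!: finsum_closed simp: matrices_closed coords_closed)

lemma mat_act_cong:
  assumes "X \<in> matrices F \<beta>' \<beta>" "x \<in> coords \<beta>' s"
    and "\<And>i j. \<lbrakk>i \<in> dom \<beta>; j \<in> dom \<beta>'; t \<in> bar \<beta> i\<rbrakk> \<Longrightarrow> Y (i, j) \<otimes> y j = X (i, j) \<otimes> x j"
  shows "mat_act \<beta>' \<beta> Y t y = mat_act \<beta>' \<beta> X t x"
  unfolding mat_act_def
proof (rule restrict_ext)
  fix i assume i: "i \<in> dom \<beta>"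
  have "(\<Oplus>j\<in>dom \<beta>'. Y (i, j) \<otimes> y j) = (\<Oplus>j\<in>dom \<beta>'. X (i, j) \<otimes> x j)" if "t \<in> bar \<beta> i"
    using assms i that
    by (intro finsum_cong') (auto simp: matrices_closed coords_closed)
  then show "(if t \<in> bar \<beta> i then \<Oplus>j\<in>dom \<beta>'. Y (i, j) \<otimes> y j else \<zero>) =
      (if t \<in> bar \<beta> i then \<Oplus>j\<in>dom \<beta>'. X (i, j) \<otimes> x j else \<zero>)"
    by simp
qed

lemma vector_element_matrix_vector:
  "vector_element F e \<beta> t (matrix_vector F (dom \<beta>) (dom \<beta>') X u) = e (mat_act \<beta>' \<beta> X t u)"
  unfolding vector_element_def matrix_vector_def mat_act_def e_eq_iff
  by (rule restrict_ext) simp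

lemma coords_in_vectors:
  assumes "\<beta> \<in> barcodes R" "t \<in> R" "x \<in> coords \<beta> t"
  shows "x \<in> vectors F R \<beta> t"
  using assms
  by (auto simp: vectors_def coords_def mem_bar_iff[of _ R] cut_interval_def[of "({}, R)"]
      minus_infinity_def)

lemma vector_element_coords:
  assumes "x \<in> coords \<beta> t"
  shows "vector_element F e \<beta> t x = e x"
proof -
  have "(\<lambda>i\<in>dom \<beta>. if t \<in> bar \<beta> i then x i else \<zero>) = restrict x (dom \<beta>)"
    by (rule restrict_ext) (use assms in \<open>simp add: coords_zero\<close>)
  then show ?thesis
    by (simp only: vector_element_def coords_restrict[OF assms])
qed

text \<open>\<open>computed_by\<close> ranges over all representing vectors \<open>u\<close>, not
  only the canonical ones, so coordinates \<open>j\<close> outside their bar must not contribute to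
  a row \<open>i\<close> alive at \<open>t\<close>. Before the birth of \<open>j\<close> the
  coordinate of \<open>u\<close> is zero; after its death \<open>t\<close> witnesses that bar
  \<open>i\<close> dies later than bar \<open>j\<close>, and the entry is zero.\<close>

lemma computed_by_mat_mor:
  assumes \<beta>: "\<beta>' \<in> barcodes R" "\<beta> \<in> barcodes R" and X: "X \<in> matrices F \<beta>' \<beta>"
  shows "computed_by F R e \<beta>' \<beta> (mat_mor \<beta>' \<beta> X) X"
  unfolding computed_by_def vector_element_matrix_vector
proof (intro ballI)
  fix t u assume t: "t \<in> R" and u: "u \<in> vectors F R \<beta>' t"
  define x where "x = (\<lambda>j\<in>dom \<beta>'. if t \<in> bar \<beta>' j then u j else \<zero>)"
  have u_closed: "u j \<in> carrier F" if "j \<in> dom \<beta>'" for j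
    using u that by (auto simp: vectors_def)
  have x: "x \<in> coords \<beta>' t"
    unfolding x_def by (rule coordsI) (simp_all add: u_closed)
  have "mat_act \<beta>' \<beta> X t u = mat_act \<beta>' \<beta> X t x"
  proof (rule mat_act_cong[OF X x])
    fix i j assume ij: "i \<in> dom \<beta>" "j \<in> dom \<beta>'" and ti: "t \<in> bar \<beta> i"
    show "X (i, j) \<otimes> u j = X (i, j) \<otimes> x j"
    proof (cases "t \<in> bar \<beta>' j")
      case True
      then show ?thesis using ij by (simp add: x_def)
    next
      case False
      then consider "t \<in> lower_part (birth \<beta>' j)" | "t \<notin> lower_part (death \<beta>' j)"
        using mem_bar_iff[OF \<beta>(1) ij(2) t] by blast
      then have "u j = \<zero> \<or> X (i, j) = \<zero>"
      proof cases
        case 1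
        then show ?thesis
          using u ij t by (auto simp: vectors_def cut_interval_def minus_infinity_def)
      next
        case 2
        then show ?thesis
          using matrices_zero[OF X \<beta> ij t] ti mem_bar_iff[OF \<beta>(2) ij(1) t] by blast
      qed
      with False ij show ?thesis
        by (auto simp: x_def matrices_closed[OF X] u_closed)
    qed
  qed
  moreover have "vector_element F e \<beta>' t u = e x"
    by (simp add: vector_element_def x_def)
  ultimately show "mat_mor \<beta>' \<beta> X t (vector_element F e \<beta>' t u) = e (mat_act \<beta>' \<beta> X t u)"
    using t x by (simp add: mat_mor_e)
qed

text \<open>Linearity holds row by row. Naturality is where the two zero conditions enter: one for a
  target bar born between \<open>s\<close> and \<open>t\<close>, the other for a source bar that
  dies between them.\<close>

lemma mat_mor_in_Hom:
  assumes \<beta>: "\<beta>' \<in> barcodes R" "\<beta> \<in> barcodes R" and X: "X \<in> matrices F \<beta>' \<beta>"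
  shows "mat_mor \<beta>' \<beta> X \<in> pmod_morphisms F R (isum \<beta>') (isum \<beta>)"
proof (rule pmod_morphismsI)
  show "mat_mor \<beta>' \<beta> X \<in> extensional R" by (simp add: mat_mor_def)
next
  fix t assume t: "t \<in> R"
  note closed = matrices_closed[OF X] coords_closed
  have "(\<lambda>y\<in>e ` coords \<beta>' t. e (mat_act \<beta>' \<beta> X t (the_inv e y)))
      \<in> linear_maps F (Space (isum \<beta>') t) (Space (isum \<beta>) t)"
  proof (rule linear_maps_isumI)
    fix x assume "x \<in> coords \<beta>' t"
    with X show "mat_act \<beta>' \<beta> X t x \<in> coords \<beta> t" by (rule mat_act_in_coords)
  next
    fix x y assume xy: "x \<in> coords \<beta>' t" "y \<in> coords \<beta>' t"
    have "(\<Oplus>j\<in>dom \<beta>'. X (i, j) \<otimes> (\<lambda>j\<in>dom \<beta>'. x j \<oplus> y j) j) =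
        (\<Oplus>j\<in>dom \<beta>'. X (i, j) \<otimes> x j) \<oplus> (\<Oplus>j\<in>dom \<beta>'. X (i, j) \<otimes> y j)" if "i \<in> dom \<beta>" for i
    proof -
      have "(\<Oplus>j\<in>dom \<beta>'. X (i, j) \<otimes> (\<lambda>j\<in>dom \<beta>'. x j \<oplus> y j) j) =
          (\<Oplus>j\<in>dom \<beta>'. X (i, j) \<otimes> x j \<oplus> X (i, j) \<otimes> y j)"
        using xy that by (intro finsum_cong') (auto simp: closed r_distr)
      also have "\<dots> = (\<Oplus>j\<in>dom \<beta>'. X (i, j) \<otimes> x j) \<oplus> (\<Oplus>j\<in>dom \<beta>'. X (i, j) \<otimes> y j)"
        using xy that by (intro finsum_addf) (auto simp: closed)
      finally show ?thesis .
    qed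
    then show "mat_act \<beta>' \<beta> X t (\<lambda>j\<in>dom \<beta>'. x j \<oplus> y j) =
        (\<lambda>i\<in>dom \<beta>. mat_act \<beta>' \<beta> X t x i \<oplus> mat_act \<beta>' \<beta> X t y i)"
      unfolding mat_act_def by (intro restrict_ext) simp
  next
    fix a x assume ax: "a \<in> carrier F" "x \<in> coords \<beta>' t"
    have "(\<Oplus>j\<in>dom \<beta>'. X (i, j) \<otimes> (\<lambda>j\<in>dom \<beta>'. a \<otimes> x j) j) =
        a \<otimes> (\<Oplus>j\<in>dom \<beta>'. X (i, j) \<otimes> x j)" if "i \<in> dom \<beta>" for i
    proof -
      have "(\<Oplus>j\<in>dom \<beta>'. X (i, j) \<otimes> (\<lambda>j\<in>dom \<beta>'. a \<otimes> x j) j) =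
          (\<Oplus>j\<in>dom \<beta>'. a \<otimes> (X (i, j) \<otimes> x j))"
        using ax that by (intro finsum_cong') (auto simp: closed m_lcomm)
      also have "\<dots> = a \<otimes> (\<Oplus>j\<in>dom \<beta>'. X (i, j) \<otimes> x j)"
        using ax that barcodesD(1)[OF \<beta>(1)]
        by (intro finsum_rdistr[symmetric]) (auto simp: closed)
      finally show ?thesis .
    qed
    with ax show "mat_act \<beta>' \<beta> X t (\<lambda>j\<in>dom \<beta>'. a \<otimes> x j) =
        (\<lambda>i\<in>dom \<beta>. a \<otimes> mat_act \<beta>' \<beta> X t x i)"
      unfolding mat_act_def by (intro restrict_ext) simp
  qed
  with t show "mat_mor \<beta>' \<beta> X t \<in> linear_maps F (Space (isum \<beta>') t) (Space (isum \<beta>) t)"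
    by (simp add: mat_mor_def)
next
  fix s t y assume st: "s \<in> R" "t \<in> R" "s \<le> t" and "y \<in> carrier (Space (isum \<beta>') s)"
  then obtain x where y: "y = e x" and x: "x \<in> coords \<beta>' s"
    by (auto simp: carrier_isum)
  let ?x' = "\<lambda>j\<in>dom \<beta>'. if s \<in> bar \<beta>' j \<and> t \<in> bar \<beta>' j then x j else \<zero>"
  have x': "?x' \<in> coords \<beta>' t" by (rule coords_Tr[OF x])
  have "mat_act \<beta>' \<beta> X t ?x' i =
      (if s \<in> bar \<beta> i \<and> t \<in> bar \<beta> i then mat_act \<beta>' \<beta> X s x i else \<zero>)"
    if i: "i \<in> dom \<beta>" for i
  proof -
    note bar_i = mem_bar_iff[OF \<beta>(2) i]
    consider "t \<notin> bar \<beta> i" | "t \<in> bar \<beta> i" "s \<notin> bar \<beta> i" | "t \<in> bar \<beta> i" "s \<in> bar \<beta> i"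
      by blast
    then show ?thesis
    proof cases
      case 1
      with i show ?thesis by (simp add: mat_act_def)
    next
      \<comment> \<open>Bar \<open>i\<close> is born only after \<open>s\<close>. Any source bar
        alive at \<open>s\<close> was then born strictly earlier, with \<open>s\<close> as witness,
        so its entry is zero; a source bar not alive at \<open>s\<close> has coordinate zero after
        transition.\<close>
      case 2
      then have s: "s \<in> lower_part (birth \<beta> i)"
        using st bar_i lower_part_downward[OF barcodesD(3)[OF \<beta>(2) i] _ st(1,3)] by blast
      have "X (i, j) \<otimes> ?x' j = \<zero>" if j: "j \<in> dom \<beta>'" for j
      proof (cases "s \<in> bar \<beta>' j")
        case True
        then have "X (i, j) = \<zero>"
          using matrices_zero[OF X \<beta> i j st(1)] s mem_bar_iff[OF \<beta>(1) j st(1)] by blast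
        then show ?thesis using j x by (simp add: coords_closed)
      qed (use i j X in \<open>simp add: matrices_closed\<close>)
      then have "(\<Oplus>j\<in>dom \<beta>'. X (i, j) \<otimes> ?x' j) = (\<Oplus>j\<in>dom \<beta>'. \<zero>)"
        by (intro finsum_cong') simp_all
      with 2 i show ?thesis
        by (simp only: mat_act_def) simp
    next
      case 3
      have "X (i, j) \<otimes> ?x' j = X (i, j) \<otimes> x j" if j: "j \<in> dom \<beta>'" for j
      proof -
        consider "s \<notin> bar \<beta>' j" | "s \<in> bar \<beta>' j" "t \<notin> bar \<beta>' j" | "s \<in> bar \<beta>' j" "t \<in> bar \<beta>' j"
          by blast
        then show ?thesis
        proof cases
          case 1
          with x j show ?thesis by (simp add: coords_zero)
        next
          \<comment> \<open>The transition erases coordinate \<open>j\<close>, which has died by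
            \<open>t\<close>. Since bar \<open>i\<close> is still alive at \<open>t\<close>, that
            point witnesses the strict inequality of deaths, so the entry is zero and nothing is
            lost.\<close>
          case 2
          have "t \<notin> lower_part (birth \<beta>' j)"
            using 2 lower_part_downward[OF barcodesD(2)[OF \<beta>(1) j] _ st(1,3)]
              mem_bar_iff[OF \<beta>(1) j st(1)] by blast
          then have "X (i, j) = \<zero>"
            using 2 matrices_zero[OF X \<beta> i j st(2)] 3 bar_i[OF st(2)]
              mem_bar_iff[OF \<beta>(1) j st(2)] by blast
          with x j show ?thesis by (simp add: coords_closed)
        qed (use j in simp)
      qed
      then have "(\<Oplus>j\<in>dom \<beta>'. X (i, j) \<otimes> ?x' j) = (\<Oplus>j\<in>dom \<beta>'. X (i, j) \<otimes> x j)"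
        using i x X by (intro finsum_cong') (simp_all add: matrices_closed coords_closed)
      with 3 i show ?thesis
        by (simp only: mat_act_def) simp
    qed
  qed
  then have "mat_act \<beta>' \<beta> X t ?x' =
      (\<lambda>i\<in>dom \<beta>. if s \<in> bar \<beta> i \<and> t \<in> bar \<beta> i then mat_act \<beta>' \<beta> X s x i else \<zero>)"
    by (intro coords_ext[OF mat_act_in_coords[OF X x'] coords_Tr[OF mat_act_in_coords[OF X x]]])
      simp
  then show "mat_mor \<beta>' \<beta> X t (Tr (isum \<beta>') s t y) = Tr (isum \<beta>) s t (mat_mor \<beta>' \<beta> X s y)"
    unfolding y Tr_isum_e[OF x] mat_mor_e[OF st(2) x'] mat_mor_e[OF st(1) x]
      Tr_isum_e[OF mat_act_in_coords[OF X x]] by simp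
qed

text \<open>Every element of the sum is represented by a canonical vector, on which the matrix
  dictates the value. This uniqueness is what makes both functors, defined by descriptions, well
  determined.\<close>

lemma computed_by_iff:
  assumes \<beta>: "\<beta>' \<in> barcodes R" "\<beta> \<in> barcodes R" and X: "X \<in> matrices F \<beta>' \<beta>"
    and \<phi>: "\<phi> \<in> pmod_morphisms F R (isum \<beta>') (isum \<beta>)"
  shows "computed_by F R e \<beta>' \<beta> \<phi> X \<longleftrightarrow> \<phi> = mat_mor \<beta>' \<beta> X"
proof
  assume comp: "computed_by F R e \<beta>' \<beta> \<phi> X"
  show "\<phi> = mat_mor \<beta>' \<beta> X"
  proof (rule pmod_morphisms_eqI[OF \<phi> mat_mor_in_Hom[OF \<beta> X]])
    fix t y assume t: "t \<in> R" and "y \<in> carrier (Space (isum \<beta>') t)"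
    then obtain x where y: "y = e x" and x: "x \<in> coords \<beta>' t"
      by (auto simp: carrier_isum)
    have "\<phi> t (vector_element F e \<beta>' t x) = e (mat_act \<beta>' \<beta> X t x)"
      using comp t coords_in_vectors[OF \<beta>(1) t x]
      by (simp add: computed_by_def vector_element_matrix_vector)
    then show "\<phi> t y = mat_mor \<beta>' \<beta> X t y"
      using t x by (simp add: y mat_mor_e vector_element_coords)
  qed
qed (simp add: computed_by_mat_mor[OF \<beta> X])

text \<open>Set to the zero family when bar \<open>j\<close> is not alive at \<open>t\<close>, so
  that it lies in \<open>coords \<beta> t\<close> for every \<open>t\<close> and a transition out of
  bar \<open>j\<close> still leads to a unit vector.\<close>

definition unit_vec :: "('i, 'r) barcode \<Rightarrow> 'r \<Rightarrow> 'i \<Rightarrow> 'i \<Rightarrow> 'f" where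
  "unit_vec \<beta> t j = (\<lambda>k\<in>dom \<beta>. if k = j \<and> t \<in> bar \<beta> j then \<one> else \<zero>)"

lemma unit_vec_in_coords: "unit_vec \<beta> t j \<in> coords \<beta> t"
  unfolding unit_vec_def by (rule coordsI) auto

lemma mat_act_unit_vec:
  assumes "\<beta>' \<in> barcodes R" "X \<in> matrices F \<beta>' \<beta>"
    and ij: "i \<in> dom \<beta>" "j \<in> dom \<beta>'" "t \<in> bar \<beta> i" "t \<in> bar \<beta>' j"
  shows "mat_act \<beta>' \<beta> X t (unit_vec \<beta>' t j) i = X (i, j)"
proof -
  have "(\<Oplus>k\<in>dom \<beta>'. X (i, k) \<otimes> unit_vec \<beta>' t j k) = X (i, j) \<otimes> unit_vec \<beta>' t j j"
    using assms barcodesD(1)[OF assms(1)]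
    by (intro finsum_single) (auto simp: unit_vec_def matrices_closed)
  also have "\<dots> = X (i, j)"
    using assms by (simp add: unit_vec_def matrices_closed)
  finally show ?thesis
    using ij by (simp add: mat_act_def)
qed

text \<open>The relation on matrices is exactly the kernel of their action: applying the morphism to
  a unit vector reads off an entry wherever the two bars meet, and only entries at such bars
  influence the action.\<close>

lemma mat_mor_eq_iff:
  assumes \<beta>: "\<beta>' \<in> barcodes R" "\<beta> \<in> barcodes R"
    and X: "X \<in> matrices F \<beta>' \<beta>" and Y: "Y \<in> matrices F \<beta>' \<beta>"
  shows "mat_mor \<beta>' \<beta> X = mat_mor \<beta>' \<beta> Y \<longleftrightarrow> (X, Y) \<in> matrix_rel F \<beta>' \<beta>"
proof
  assume eq: "mat_mor \<beta>' \<beta> X = mat_mor \<beta>' \<beta> Y"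
  show "(X, Y) \<in> matrix_rel F \<beta>' \<beta>"
    unfolding matrix_rel_iff[OF \<beta>]
  proof (intro conjI X Y ballI impI)
    fix i j t
    assume ij: "i \<in> dom \<beta>" "j \<in> dom \<beta>'" and t: "t \<in> R"
      and bd: "t \<notin> lower_part (birth \<beta>' j) \<and> t \<in> lower_part (death \<beta> i)"
    show "X (i, j) = Y (i, j)"
    proof (cases "t \<in> bar \<beta> i \<and> t \<in> bar \<beta>' j")
      case True
      have "mat_act \<beta>' \<beta> X t (unit_vec \<beta>' t j) = mat_act \<beta>' \<beta> Y t (unit_vec \<beta>' t j)"
        using fun_cong[OF fun_cong[OF eq, of t], of "e (unit_vec \<beta>' t j)"] t
        by (simp add: mat_mor_e unit_vec_in_coords)
      with True ij show ?thesis
        using mat_act_unit_vec[OF \<beta>(1) X ij, of t] mat_act_unit_vec[OF \<beta>(1) Y ij, of t]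
        by metis
    next
      case False
      \<comment> \<open>If \<open>t\<close> misses one of the bars, then it comes either before the
        birth of \<open>i\<close> or after the death of \<open>j\<close>. The same \<open>t\<close>
        is then a witness for a zero condition, which holds for both matrices.\<close>
      with bd have "t \<notin> lower_part (birth \<beta>' j) \<and> t \<in> lower_part (birth \<beta> i) \<or>
          t \<notin> lower_part (death \<beta>' j) \<and> t \<in> lower_part (death \<beta> i)"
        using mem_bar_iff[OF \<beta>(2) ij(1) t] mem_bar_iff[OF \<beta>(1) ij(2) t] by blast
      then show ?thesis
        using matrices_zero[OF X \<beta> ij t] matrices_zero[OF Y \<beta> ij t] by simp
    qed
  qed
next
  assume rel: "(X, Y) \<in> matrix_rel F \<beta>' \<beta>"
  show "mat_mor \<beta>' \<beta> X = mat_mor \<beta>' \<beta> Y"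
  proof (rule pmod_morphisms_eqI[OF mat_mor_in_Hom[OF \<beta> X] mat_mor_in_Hom[OF \<beta> Y]])
    fix t y assume t: "t \<in> R" and "y \<in> carrier (Space (isum \<beta>') t)"
    then obtain x where y: "y = e x" and x: "x \<in> coords \<beta>' t"
      by (auto simp: carrier_isum)
    have "mat_act \<beta>' \<beta> X t x = mat_act \<beta>' \<beta> Y t x"
    proof (rule mat_act_cong[OF Y x])
      fix i j assume ij: "i \<in> dom \<beta>" "j \<in> dom \<beta>'" and ti: "t \<in> bar \<beta> i"
      show "X (i, j) \<otimes> x j = Y (i, j) \<otimes> x j"
      proof (cases "t \<in> bar \<beta>' j")
        case True
        then have "X (i, j) = Y (i, j)"
          using rel ti ij t mem_bar_iff[OF \<beta>(2) ij(1) t] mem_bar_iff[OF \<beta>(1) ij(2) t]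
          unfolding matrix_rel_iff[OF \<beta>] by blast
        then show ?thesis by simp
      next
        case False
        then show ?thesis
          using ij x X Y by (simp add: coords_zero matrices_closed)
      qed
    qed
    with t x show "mat_mor \<beta>' \<beta> X t y = mat_mor \<beta>' \<beta> Y t y"
      by (simp add: y mat_mor_e)
  qed
qed

section \<open>Recovering a matrix from a morphism\<close>

definition coord_map :: "('r \<Rightarrow> 'v \<Rightarrow> 'v) \<Rightarrow> 'r \<Rightarrow> ('i \<Rightarrow> 'f) \<Rightarrow> 'i \<Rightarrow> 'f" where
  "coord_map \<phi> t x = the_inv e (\<phi> t (e x))"

lemma coord_map:
  assumes \<phi>: "\<phi> \<in> pmod_morphisms F R (isum \<beta>') (isum \<beta>)"
  shows "\<And>t x. \<lbrakk>t \<in> R; x \<in> coords \<beta>' t\<rbrakk> \<Longrightarrow> \<phi> t (e x) = e (coord_map \<phi> t x)"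
    and "\<And>t x. \<lbrakk>t \<in> R; x \<in> coords \<beta>' t\<rbrakk> \<Longrightarrow> coord_map \<phi> t x \<in> coords \<beta> t"
    and "\<And>t x y i. \<lbrakk>t \<in> R; x \<in> coords \<beta>' t; y \<in> coords \<beta>' t; i \<in> dom \<beta>\<rbrakk>
      \<Longrightarrow> coord_map \<phi> t (\<lambda>j\<in>dom \<beta>'. x j \<oplus> y j) i = coord_map \<phi> t x i \<oplus> coord_map \<phi> t y i"
    and "\<And>t a x i. \<lbrakk>t \<in> R; a \<in> carrier F; x \<in> coords \<beta>' t; i \<in> dom \<beta>\<rbrakk>
      \<Longrightarrow> coord_map \<phi> t (\<lambda>j\<in>dom \<beta>'. a \<otimes> x j) i = a \<otimes> coord_map \<phi> t x i"
    and "\<And>s t x i. \<lbrakk>s \<in> R; t \<in> R; s \<le> t; x \<in> coords \<beta>' s; i \<in> dom \<beta>\<rbrakk>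
      \<Longrightarrow> coord_map \<phi> t (\<lambda>j\<in>dom \<beta>'. if s \<in> bar \<beta>' j \<and> t \<in> bar \<beta>' j then x j else \<zero>) i =
        (if s \<in> bar \<beta> i \<and> t \<in> bar \<beta> i then coord_map \<phi> s x i else \<zero>)"
proof -
  let ?f = "coord_map \<phi>"
  have lin: "\<phi> t \<in> linear_maps F (Space (isum \<beta>') t) (Space (isum \<beta>) t)" if "t \<in> R" for t
    using \<phi> that by (rule pmod_morphismsD(2))
  have f: "\<phi> t (e x) = e (?f t x) \<and> ?f t x \<in> coords \<beta> t" if "t \<in> R" "x \<in> coords \<beta>' t" for t x
  proof -
    have "\<phi> t (e x) \<in> e ` coords \<beta> t"
      using linear_maps_mem[OF lin[OF that(1)], of "e x"] that(2) by (simp add: carrier_isum)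
    then show ?thesis by (auto simp: coord_map_def)
  qed
  {
    fix t x assume "t \<in> R" "x \<in> coords \<beta>' t"
    then show "\<phi> t (e x) = e (?f t x)" "?f t x \<in> coords \<beta> t" using f by blast+
  }
  {
    fix t x y i assume *: "t \<in> R" "x \<in> coords \<beta>' t" "y \<in> coords \<beta>' t" "i \<in> dom \<beta>"
    have "\<phi> t (e x \<oplus>\<^bsub>Space (isum \<beta>') t\<^esub> e y) = \<phi> t (e x) \<oplus>\<^bsub>Space (isum \<beta>) t\<^esub> \<phi> t (e y)"
      using * by (intro linear_mapsD(2)[OF lin]) (simp_all add: carrier_isum)
    then have "?f t (\<lambda>j\<in>dom \<beta>'. x j \<oplus> y j) = (\<lambda>i\<in>dom \<beta>. ?f t x i \<oplus> ?f t y i)"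
      using * f by (simp add: isum_simps coords_add)
    with * show "?f t (\<lambda>j\<in>dom \<beta>'. x j \<oplus> y j) i = ?f t x i \<oplus> ?f t y i" by simp
  }
  {
    fix t a x i assume *: "t \<in> R" "a \<in> carrier F" "x \<in> coords \<beta>' t" "i \<in> dom \<beta>"
    have "\<phi> t (a \<odot>\<^bsub>Space (isum \<beta>') t\<^esub> e x) = a \<odot>\<^bsub>Space (isum \<beta>) t\<^esub> \<phi> t (e x)"
      using * by (intro linear_mapsD(3)[OF lin]) (simp_all add: carrier_isum)
    then have "?f t (\<lambda>j\<in>dom \<beta>'. a \<otimes> x j) = (\<lambda>i\<in>dom \<beta>. a \<otimes> ?f t x i)"
      using * f by (simp add: isum_simps coords_smult)
    with * show "?f t (\<lambda>j\<in>dom \<beta>'. a \<otimes> x j) i = a \<otimes> ?f t x i" by simp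
  }
  {
    fix s t x i assume *: "s \<in> R" "t \<in> R" "s \<le> t" and x: "x \<in> coords \<beta>' s" and i: "i \<in> dom \<beta>"
    have "\<phi> t (Tr (isum \<beta>') s t (e x)) = Tr (isum \<beta>) s t (\<phi> s (e x))"
      using x by (intro pmod_morphismsD(3)[OF \<phi> *]) (simp add: carrier_isum)
    then have "?f t (\<lambda>j\<in>dom \<beta>'. if s \<in> bar \<beta>' j \<and> t \<in> bar \<beta>' j then x j else \<zero>) =
        (\<lambda>i\<in>dom \<beta>. if s \<in> bar \<beta> i \<and> t \<in> bar \<beta> i then ?f s x i else \<zero>)"
      using *(1,2) x f[OF *(1) x] f[OF *(2) coords_Tr[OF x]]
      by (simp add: Tr_isum_e)
    with i show "?f t (\<lambda>j\<in>dom \<beta>'. if s \<in> bar \<beta>' j \<and> t \<in> bar \<beta>' j then x j else \<zero>) i =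
        (if s \<in> bar \<beta> i \<and> t \<in> bar \<beta> i then ?f s x i else \<zero>)" by simp
  }
qed

text \<open>Induction on a finite set \<open>J\<close> of indices outside which \<open>x\<close>
  vanishes, splitting off one coordinate at a time. Indices whose bar is not alive at
  \<open>t\<close> do no harm, since both the unit vector and the coordinate are zero there.\<close>

lemma coords_functional_expansion:
  assumes \<beta>: "\<beta> \<in> barcodes R"
    and closed: "\<And>x. x \<in> coords \<beta> t \<Longrightarrow> g x \<in> carrier F"
    and add: "\<And>x y. \<lbrakk>x \<in> coords \<beta> t; y \<in> coords \<beta> t\<rbrakk>
      \<Longrightarrow> g (\<lambda>j\<in>dom \<beta>. x j \<oplus> y j) = g x \<oplus> g y"
    and smult: "\<And>a x. \<lbrakk>a \<in> carrier F; x \<in> coords \<beta> t\<rbrakk> \<Longrightarrow> g (\<lambda>j\<in>dom \<beta>. a \<otimes> x j) = a \<otimes> g x"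
    and x: "x \<in> coords \<beta> t"
  shows "g x = (\<Oplus>j\<in>dom \<beta>. g (unit_vec \<beta> t j) \<otimes> x j)"
proof -
  have unit: "g (unit_vec \<beta> t j) \<in> carrier F" for j
    by (rule closed[OF unit_vec_in_coords])
  have "g x = (\<Oplus>j\<in>J. g (unit_vec \<beta> t j) \<otimes> x j)"
    if "finite J" "J \<subseteq> dom \<beta>" "x \<in> coords \<beta> t" "\<And>j. j \<in> dom \<beta> - J \<Longrightarrow> x j = \<zero>" for J x
    using that
  proof (induction J arbitrary: x rule: finite_induct)
    case (empty x)
    have "x = (\<lambda>j\<in>dom \<beta>. \<zero> \<otimes> x j)"
      using empty by (intro coords_ext[of _ \<beta> t] coords_smult) (simp_all add: coords_closed)
    then have "g x = \<zero> \<otimes> g x"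
      using smult[of \<zero> x] empty by simp
    then show ?case
      using closed[of x] empty by simp
  next
    case (insert k J x)
    note x = \<open>x \<in> coords \<beta> t\<close>
    have k: "k \<in> dom \<beta>" and J: "J \<subseteq> dom \<beta>" using insert.prems by auto
    \<comment> \<open>Erasing coordinate \<open>k\<close> leaves a family supported in
      \<open>J\<close>, to which the induction hypothesis applies; the difference from
      \<open>x\<close> is a multiple of a unit vector.\<close>
    define x' where "x' = (\<lambda>j\<in>dom \<beta>. if j = k then \<zero> else x j)"
    have x': "x' \<in> coords \<beta> t"
      unfolding x'_def by (rule coordsI) (use x in \<open>simp_all add: coords_closed coords_zero\<close>)
    have xk: "x k \<in> carrier F" using x k by (rule coords_closed)
    let ?y = "\<lambda>j\<in>dom \<beta>. x k \<otimes> unit_vec \<beta> t k j"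
    have y: "?y \<in> coords \<beta> t"
      using xk by (intro coords_smult unit_vec_in_coords)
    have "x = (\<lambda>j\<in>dom \<beta>. x' j \<oplus> ?y j)"
    proof (rule coords_ext[OF x coords_add[OF x' y]])
      fix j assume j: "j \<in> dom \<beta>"
      then show "x j = (\<lambda>j\<in>dom \<beta>. x' j \<oplus> ?y j) j"
        using x k by (auto simp: x'_def unit_vec_def coords_closed coords_zero)
    qed
    then have "g x = g x' \<oplus> x k \<otimes> g (unit_vec \<beta> t k)"
      using add[OF x' y] smult[OF xk unit_vec_in_coords, of k] by simp
    also have "g x' = (\<Oplus>j\<in>J. g (unit_vec \<beta> t j) \<otimes> x' j)"
      using insert.prems by (intro insert.IH J x') (auto simp: x'_def)
    also have "\<dots> = (\<Oplus>j\<in>J. g (unit_vec \<beta> t j) \<otimes> x j)"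
    proof (rule finsum_cong'[OF refl])
      show "(\<lambda>j. g (unit_vec \<beta> t j) \<otimes> x j) \<in> J \<rightarrow> carrier F"
        using J by (auto intro!: m_closed unit coords_closed[OF x])
      show "g (unit_vec \<beta> t j) \<otimes> x' j = g (unit_vec \<beta> t j) \<otimes> x j" if "j \<in> J" for j
        using that insert.hyps J by (auto simp: x'_def)
    qed
    also have "\<dots> \<oplus> x k \<otimes> g (unit_vec \<beta> t k) =
        (\<Oplus>j\<in>insert k J. g (unit_vec \<beta> t j) \<otimes> x j)"
      using insert.hyps J x xk
      by (subst finsum_insert) (auto simp: unit m_comm intro!: a_comm finsum_closed m_closed coords_closed[OF x])
    finally show ?case .
  qed
  from this[of "dom \<beta>" x] x barcodesD(1)[OF \<beta>] show ?thesis by simp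
qed

text \<open>
  The entry \<open>(i, j)\<close> of the matrix of a morphism is the value, at any point common to both bars,
  of its component from bar \<open>j\<close> to bar \<open>i\<close>; naturality makes it independent of the point, and
  forces it to vanish as soon as one of the endpoint inequalities fails.
\<close>

lemma mat_mor_surj:
  assumes \<beta>: "\<beta>' \<in> barcodes R" "\<beta> \<in> barcodes R"
    and \<phi>: "\<phi> \<in> pmod_morphisms F R (isum \<beta>') (isum \<beta>)"
  obtains X where "X \<in> matrices F \<beta>' \<beta>" "\<phi> = mat_mor \<beta>' \<beta> X"
proof -
  define f where "f = coord_map \<phi>"
  note f = coord_map(1)[OF \<phi>, folded f_def] and f_coords = coord_map(2)[OF \<phi>, folded f_def]
    and f_add = coord_map(3)[OF \<phi>, folded f_def] and f_smult = coord_map(4)[OF \<phi>, folded f_def]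
    and f_Tr = coord_map(5)[OF \<phi>, folded f_def]
  \<comment> \<open>The candidate entry at time \<open>t\<close>: the scalar by which the morphism
    maps bar \<open>j\<close> to bar \<open>i\<close> there.\<close>
  define a where "a = (\<lambda>t i j. f t (unit_vec \<beta>' t j) i)"
  have a_closed: "a t i j \<in> carrier F" if "t \<in> R" "i \<in> dom \<beta>" for t i j
    using coords_closed[OF f_coords[OF that(1) unit_vec_in_coords] that(2)] by (simp add: a_def)
  have expand: "f t x i = (\<Oplus>j\<in>dom \<beta>'. a t i j \<otimes> x j)"
    if "t \<in> R" "x \<in> coords \<beta>' t" "i \<in> dom \<beta>" for t x i
    unfolding a_def using that
    by (intro coords_functional_expansion[where g = "\<lambda>x. f t x i"] \<beta>(1))
      (auto simp: f_add f_smult intro: coords_closed[OF f_coords])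
  \<comment> \<open>Naturality on the unit vector of bar \<open>j\<close>. Only \<open>s\<close> is
    required to lie in that bar: if \<open>t\<close> does not, the unit vector at \<open>t\<close>
    is zero, and this case yields the death condition below.\<close>
  have a_Tr: "a t i j = (if s \<in> bar \<beta> i \<and> t \<in> bar \<beta> i then a s i j else \<zero>)"
    if "s \<in> R" "t \<in> R" "s \<le> t" "i \<in> dom \<beta>" "s \<in> bar \<beta>' j" for s t i j
  proof -
    have "(\<lambda>k\<in>dom \<beta>'. if s \<in> bar \<beta>' k \<and> t \<in> bar \<beta>' k then unit_vec \<beta>' s j k else \<zero>) =
        unit_vec \<beta>' t j"
      unfolding unit_vec_def by (rule restrict_ext) (use that in auto)
    then show ?thesis
      using f_Tr[OF that(1-3) unit_vec_in_coords that(4), of j] by (simp add: a_def)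
  qed
  have a_zero: "a t i j = \<zero>" if "t \<in> R" "i \<in> dom \<beta>" "t \<notin> bar \<beta>' j" for t i j
  proof -
    have "unit_vec \<beta>' t j = (\<lambda>k\<in>dom \<beta>'. \<zero> \<otimes> unit_vec \<beta>' t j k)"
      unfolding unit_vec_def by (rule restrict_ext) (use that in simp)
    then have "a t i j = \<zero> \<otimes> a t i j"
      using f_smult[OF that(1) zero_closed unit_vec_in_coords that(2), of j] by (simp add: a_def)
    then show ?thesis using a_closed[OF that(1,2)] by simp
  qed
  have a_const: "a t i j = a s i j"
    if "s \<in> R" "t \<in> R" "i \<in> dom \<beta>" "s \<in> bar \<beta>' j" "s \<in> bar \<beta> i" "t \<in> bar \<beta>' j" "t \<in> bar \<beta> i"
    for s t i j
    using that a_Tr[of s t i j] a_Tr[of t s i j] by (cases "s \<le> t") auto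
  \<comment> \<open>By \<open>a_const\<close> the choice of the common point is immaterial. For
    disjoint bars no scalar can be read off; the default zero meets every zero condition.\<close>
  define X where "X = (\<lambda>(i, j)\<in>dom \<beta> \<times> dom \<beta>'.
      if \<exists>t\<in>R. t \<in> bar \<beta> i \<and> t \<in> bar \<beta>' j
      then a (SOME t. t \<in> R \<and> t \<in> bar \<beta> i \<and> t \<in> bar \<beta>' j) i j else \<zero>)"
  have X_eq: "X (i, j) = a t i j"
    if "i \<in> dom \<beta>" "j \<in> dom \<beta>'" "t \<in> R" "t \<in> bar \<beta> i" "t \<in> bar \<beta>' j" for i j t
  proof -
    let ?s = "SOME t. t \<in> R \<and> t \<in> bar \<beta> i \<and> t \<in> bar \<beta>' j"
    have "?s \<in> R \<and> ?s \<in> bar \<beta> i \<and> ?s \<in> bar \<beta>' j"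
      by (rule someI[of _ t]) (use that in simp)
    then show ?thesis
      using that a_const[of t ?s i j] by (auto simp: X_def)
  qed
  have X_zero: "X (i, j) = \<zero>"
    if "i \<in> dom \<beta>" "j \<in> dom \<beta>'" "\<And>t. \<lbrakk>t \<in> R; t \<in> bar \<beta> i; t \<in> bar \<beta>' j\<rbrakk> \<Longrightarrow> a t i j = \<zero>"
    for i j
  proof (cases "\<exists>t\<in>R. t \<in> bar \<beta> i \<and> t \<in> bar \<beta>' j")
    case True
    then show ?thesis using X_eq[OF that(1,2)] that(3) by auto
  qed (use that in \<open>auto simp: X_def\<close>)
  have "X (i, j) \<in> carrier F" if "i \<in> dom \<beta>" "j \<in> dom \<beta>'" for i j
  proof (cases "\<exists>t\<in>R. t \<in> bar \<beta> i \<and> t \<in> bar \<beta>' j")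
    case True
    then show ?thesis using X_eq[OF that] a_closed that by auto
  qed (use that in \<open>auto simp: X_def\<close>)
  then have "X \<in> (dom \<beta> \<times> dom \<beta>') \<rightarrow>\<^sub>E carrier F"
    by (intro PiE_I) (auto simp: X_def)
  moreover have "X (i, j) = \<zero>"
    if ij: "i \<in> dom \<beta>" "j \<in> dom \<beta>'" and s: "s \<in> R"
      and less: "s \<notin> lower_part (birth \<beta>' j) \<and> s \<in> lower_part (birth \<beta> i) \<or>
        s \<notin> lower_part (death \<beta>' j) \<and> s \<in> lower_part (death \<beta> i)" for i j s
  proof (rule X_zero[OF ij])
    fix t assume t: "t \<in> R" "t \<in> bar \<beta> i" "t \<in> bar \<beta>' j"
    note bars = mem_bar_iff[OF \<beta>(2) ij(1)] mem_bar_iff[OF \<beta>(1) ij(2)]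
    from less show "a t i j = \<zero>"
    proof
      \<comment> \<open>Here \<open>s\<close> precedes \<open>t\<close> and lies in bar
        \<open>j\<close> but before the birth of \<open>i\<close>. Transition from \<open>s\<close>
        to \<open>t\<close> carries a zero coordinate to the entry.\<close>
      assume *: "s \<notin> lower_part (birth \<beta>' j) \<and> s \<in> lower_part (birth \<beta> i)"
      have "\<not> t \<le> s"
        using * t bars lower_part_downward[OF barcodesD(2)[OF \<beta>(2) ij(1)] _ t(1)] by blast
      then have "s \<le> t" by simp
      then have "s \<in> bar \<beta>' j"
        using * t s bars lower_part_downward[OF barcodesD(3)[OF \<beta>(1) ij(2)] _ s] by blast
      then show ?thesis
        using a_Tr[OF s t(1) \<open>s \<le> t\<close> ij(1)] * bars(1)[OF s] by simp
    next
      \<comment> \<open>Here \<open>s\<close> follows \<open>t\<close> and lies in bar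
        \<open>i\<close> but after the death of \<open>j\<close>. Transition within bar
        \<open>i\<close> preserves the scalar, while at \<open>s\<close> there is nothing left to
        map, so it is zero.\<close>
      assume *: "s \<notin> lower_part (death \<beta>' j) \<and> s \<in> lower_part (death \<beta> i)"
      have "\<not> s \<le> t"
        using * t bars lower_part_downward[OF barcodesD(3)[OF \<beta>(1) ij(2)] _ s] by blast
      then have "t \<le> s" by simp
      then have "s \<in> bar \<beta> i"
        using * t s bars lower_part_downward[OF barcodesD(2)[OF \<beta>(2) ij(1)] _ t(1)] by blast
      then show ?thesis
        using a_Tr[OF t(1) s \<open>t \<le> s\<close> ij(1) t(3)] a_zero[OF s ij(1), of j] * t bars(2)[OF s]
        by simp
    qed
  qed
  ultimately have X: "X \<in> matrices F \<beta>' \<beta>"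
    unfolding matrices_iff[OF \<beta>] by simp
  have "\<phi> = mat_mor \<beta>' \<beta> X"
  proof (rule pmod_morphisms_eqI[OF \<phi> mat_mor_in_Hom[OF \<beta> X]])
    fix t y assume t: "t \<in> R" and "y \<in> carrier (Space (isum \<beta>') t)"
    then obtain x where y: "y = e x" and x: "x \<in> coords \<beta>' t"
      by (auto simp: carrier_isum)
    have "f t x = mat_act \<beta>' \<beta> X t x"
    proof (rule coords_ext[OF f_coords[OF t x] mat_act_in_coords[OF X x]])
      fix i assume i: "i \<in> dom \<beta>"
      show "f t x i = mat_act \<beta>' \<beta> X t x i"
      proof (cases "t \<in> bar \<beta> i")
        case True
        have "f t x i = (\<Oplus>j\<in>dom \<beta>'. X (i, j) \<otimes> x j)"
          unfolding expand[OF t x i]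
        proof (rule finsum_cong'[OF refl])
          show "(\<lambda>j. X (i, j) \<otimes> x j) \<in> dom \<beta>' \<rightarrow> carrier F"
            using X x i by (auto simp: matrices_closed coords_closed)
          \<comment> \<open>Outside bar \<open>j\<close> the entry of \<open>X\<close> and the
            scalar at \<open>t\<close> may differ, but there the coordinate of \<open>x\<close>
            vanishes.\<close>
          show "a t i j \<otimes> x j = X (i, j) \<otimes> x j" if j: "j \<in> dom \<beta>'" for j
            using X_eq[OF i j t True] coords_zero[OF x j] a_closed[OF t i]
              matrices_closed[OF X i j]
            by (cases "t \<in> bar \<beta>' j") simp_all
        qed
        with True i show ?thesis by (simp add: mat_act_def)
      next
        case False
        with i show ?thesis
          using coords_zero[OF f_coords[OF t x] i] by (simp add: mat_act_def)
      qed
    qed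
    with t x show "\<phi> t y = mat_mor \<beta>' \<beta> X t y"
      by (simp add: y f mat_mor_e)
  qed
  with X show thesis by (rule that)
qed

section \<open>Matrix products and identity matrices as morphisms\<close>

lemma matrix_mult_in_matrices:
  assumes \<beta>: "\<alpha> \<in> barcodes R" "\<beta> \<in> barcodes R" "\<gamma> \<in> barcodes R"
    and X: "X \<in> matrices F \<beta> \<gamma>" and Y: "Y \<in> matrices F \<alpha> \<beta>"
  shows "matrix_mult F (dom \<gamma>) (dom \<beta>) (dom \<alpha>) X Y \<in> matrices F \<alpha> \<gamma>"
  unfolding matrices_iff[OF \<beta>(1,3)]
proof (intro conjI ballI impI)
  show "matrix_mult F (dom \<gamma>) (dom \<beta>) (dom \<alpha>) X Y \<in> dom \<gamma> \<times> dom \<alpha> \<rightarrow>\<^sub>E carrier F"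
    using X Y unfolding matrix_mult_def
    by (auto intro!: finsum_closed simp: matrices_closed)
  fix i k t assume ik: "i \<in> dom \<gamma>" "k \<in> dom \<alpha>" and t: "t \<in> R"
    and less: "t \<notin> lower_part (birth \<alpha> k) \<and> t \<in> lower_part (birth \<gamma> i) \<or>
      t \<notin> lower_part (death \<alpha> k) \<and> t \<in> lower_part (death \<gamma> i)"
  have "X (i, j) \<otimes> Y (j, k) = \<zero>" if j: "j \<in> dom \<beta>" for j
  proof -
    \<comment> \<open>The endpoint of the intermediate bar \<open>j\<close> lies on one side of
      \<open>t\<close>; depending on the side, \<open>t\<close> witnesses the zero condition for the
      entry of \<open>Y\<close> or for that of \<open>X\<close>.\<close>
    have "X (i, j) = \<zero> \<or> Y (j, k) = \<zero>"
      using less matrices_zero[OF X \<beta>(2,3) ik(1) j t] matrices_zero[OF Y \<beta>(1,2) j ik(2) t] by blast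
    then show ?thesis
      using matrices_closed[OF X ik(1) j] matrices_closed[OF Y j ik(2)] by auto
  qed
  then have "(\<Oplus>j\<in>dom \<beta>. X (i, j) \<otimes> Y (j, k)) = (\<Oplus>j\<in>dom \<beta>. \<zero>)"
    by (intro finsum_cong') auto
  with ik show "matrix_mult F (dom \<gamma>) (dom \<beta>) (dom \<alpha>) X Y (i, k) = \<zero>"
    by (simp add: matrix_mult_def)
qed

text \<open>Apart from exchanging two sums, the point is that acting twice truncates the
  intermediate coordinates \<open>j\<close>, whereas the matrix product keeps all of them. The extra
  terms vanish: before the birth of \<open>j\<close> either \<open>x k\<close> or the entry of
  \<open>Y\<close> is zero, and after its death the entry of \<open>X\<close> is zero because bar
  \<open>i\<close> is alive.\<close>

lemma mat_act_matrix_mult: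
  assumes \<beta>: "\<alpha> \<in> barcodes R" "\<beta> \<in> barcodes R" "\<gamma> \<in> barcodes R"
    and X: "X \<in> matrices F \<beta> \<gamma>" and Y: "Y \<in> matrices F \<alpha> \<beta>"
    and t: "t \<in> R" and x: "x \<in> coords \<alpha> t"
  shows "mat_act \<alpha> \<gamma> (matrix_mult F (dom \<gamma>) (dom \<beta>) (dom \<alpha>) X Y) t x =
    mat_act \<beta> \<gamma> X t (mat_act \<alpha> \<beta> Y t x)"
proof -
  let ?Z = "matrix_mult F (dom \<gamma>) (dom \<beta>) (dom \<alpha>) X Y"
  note fin = barcodesD(1)[OF \<beta>(1)] barcodesD(1)[OF \<beta>(2)]
  have Yx: "Y (j, k) \<otimes> x k \<in> carrier F" if "j \<in> dom \<beta>" "k \<in> dom \<alpha>" for j k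
    using that Y x by (simp add: matrices_closed coords_closed)
  have "(\<Oplus>k\<in>dom \<alpha>. ?Z (i, k) \<otimes> x k) = (\<Oplus>j\<in>dom \<beta>. X (i, j) \<otimes> mat_act \<alpha> \<beta> Y t x j)"
    if i: "i \<in> dom \<gamma>" and ti: "t \<in> bar \<gamma> i" for i
  proof -
    have XYx: "X (i, j) \<otimes> (Y (j, k) \<otimes> x k) \<in> carrier F" if "j \<in> dom \<beta>" "k \<in> dom \<alpha>" for j k
      using that i X Yx by (simp add: matrices_closed)
    have "(\<Oplus>k\<in>dom \<alpha>. ?Z (i, k) \<otimes> x k) =
        (\<Oplus>k\<in>dom \<alpha>. \<Oplus>j\<in>dom \<beta>. X (i, j) \<otimes> (Y (j, k) \<otimes> x k))"
    proof (rule finsum_cong'[OF refl])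
      fix k assume k: "k \<in> dom \<alpha>"
      have "?Z (i, k) \<otimes> x k = (\<Oplus>j\<in>dom \<beta>. X (i, j) \<otimes> Y (j, k) \<otimes> x k)"
        using i k fin(2) X Y x unfolding matrix_mult_def
        by (simp, intro finsum_ldistr) (auto simp: matrices_closed coords_closed)
      also have "\<dots> = (\<Oplus>j\<in>dom \<beta>. X (i, j) \<otimes> (Y (j, k) \<otimes> x k))"
        using i k X Y x
        by (intro finsum_cong') (auto simp: matrices_closed coords_closed m_assoc)
      finally show "?Z (i, k) \<otimes> x k = (\<Oplus>j\<in>dom \<beta>. X (i, j) \<otimes> (Y (j, k) \<otimes> x k))" .
    qed (auto intro!: finsum_closed XYx)
    also have "\<dots> = (\<Oplus>j\<in>dom \<beta>. \<Oplus>k\<in>dom \<alpha>. X (i, j) \<otimes> (Y (j, k) \<otimes> x k))"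
      by (intro finsum_swap fin XYx)
    also have "\<dots> = (\<Oplus>j\<in>dom \<beta>. X (i, j) \<otimes> mat_act \<alpha> \<beta> Y t x j)"
    proof (rule finsum_cong'[OF refl])
      show "(\<lambda>j. X (i, j) \<otimes> mat_act \<alpha> \<beta> Y t x j) \<in> dom \<beta> \<rightarrow> carrier F"
        using i X coords_closed[OF mat_act_in_coords[OF Y x, of t]]
        by (auto simp: matrices_closed)
      fix j assume j: "j \<in> dom \<beta>"
      have Xij: "X (i, j) \<in> carrier F" using X i j by (rule matrices_closed)
      have sum: "(\<Oplus>k\<in>dom \<alpha>. X (i, j) \<otimes> (Y (j, k) \<otimes> x k)) =
          X (i, j) \<otimes> (\<Oplus>k\<in>dom \<alpha>. Y (j, k) \<otimes> x k)"
        using Yx j by (intro finsum_rdistr[symmetric] fin Xij) auto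
      show "(\<Oplus>k\<in>dom \<alpha>. X (i, j) \<otimes> (Y (j, k) \<otimes> x k)) = X (i, j) \<otimes> mat_act \<alpha> \<beta> Y t x j"
      proof (cases "t \<in> bar \<beta> j")
        case True
        with j show ?thesis by (simp add: sum mat_act_def)
      next
        case False
        have "X (i, j) \<otimes> (Y (j, k) \<otimes> x k) = \<zero>" if k: "k \<in> dom \<alpha>" for k
        proof -
          have "X (i, j) = \<zero> \<or> Y (j, k) = \<zero> \<or> x k = \<zero>"
            using False ti matrices_zero[OF X \<beta>(2,3) i j t] matrices_zero[OF Y \<beta>(1,2) j k t]
              coords_zero[OF x k] mem_bar_iff[OF \<beta>(3) i t] mem_bar_iff[OF \<beta>(2) j t]
              mem_bar_iff[OF \<beta>(1) k t] by blast
          then show ?thesis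
            using Xij matrices_closed[OF Y j k] coords_closed[OF x k] by auto
        qed
        then have "(\<Oplus>k\<in>dom \<alpha>. X (i, j) \<otimes> (Y (j, k) \<otimes> x k)) = (\<Oplus>k\<in>dom \<alpha>. \<zero>)"
          by (intro finsum_cong') auto
        with False j Xij show ?thesis by (simp add: mat_act_def)
      qed
    qed
    finally show ?thesis .
  qed
  then show ?thesis
    by (subst (1 2) mat_act_def) (rule restrict_ext, simp)
qed

lemma mat_mor_matrix_mult:
  assumes \<beta>: "\<alpha> \<in> barcodes R" "\<beta> \<in> barcodes R" "\<gamma> \<in> barcodes R"
    and X: "X \<in> matrices F \<beta> \<gamma>" and Y: "Y \<in> matrices F \<alpha> \<beta>"
  shows "mat_mor \<alpha> \<gamma> (matrix_mult F (dom \<gamma>) (dom \<beta>) (dom \<alpha>) X Y) =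
    Cmp (pmod_category F R) (isum \<alpha>) (isum \<beta>) (isum \<gamma>) (mat_mor \<beta> \<gamma> X) (mat_mor \<alpha> \<beta> Y)"
  unfolding pmod_category_simps carrier_isum compose_def
  by (subst mat_mor_def, intro restrict_ext)
    (auto simp: mat_mor_e mat_act_matrix_mult[OF \<beta> X Y] mat_act_in_coords[OF Y])

lemma identity_matrix_in_matrices:
  assumes "\<beta> \<in> barcodes R"
  shows "identity_matrix F (dom \<beta>) \<in> matrices F \<beta> \<beta>"
  unfolding matrices_iff[OF assms assms] identity_matrix_def by auto

lemma mat_mor_identity_matrix:
  assumes \<beta>: "\<beta> \<in> barcodes R"
  shows "mat_mor \<beta> \<beta> (identity_matrix F (dom \<beta>)) = Idn (pmod_category F R) (isum \<beta>)"
proof -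
  let ?I = "identity_matrix F (dom \<beta>)"
  have "mat_act \<beta> \<beta> ?I t x = x" if x: "x \<in> coords \<beta> t" for t x
  proof (rule coords_ext[OF mat_act_in_coords[OF identity_matrix_in_matrices[OF \<beta>] x] x])
    fix i assume i: "i \<in> dom \<beta>"
    have "(\<Oplus>j\<in>dom \<beta>. ?I (i, j) \<otimes> x j) = ?I (i, i) \<otimes> x i"
      using i x by (intro finsum_single barcodesD(1)[OF \<beta>])
        (auto simp: identity_matrix_def coords_closed)
    with i x show "mat_act \<beta> \<beta> ?I t x i = x i"
      by (simp add: mat_act_def identity_matrix_def coords_closed coords_zero)
  qed
  then show ?thesis
    unfolding pmod_category_simps carrier_isum mat_mor_def
    by (intro restrict_ext) auto
qed

section \<open>Classes of matrices and their composition\<close>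

lemma matrix_class_eq_iff:
  assumes "\<beta>' \<in> barcodes R" "\<beta> \<in> barcodes R" "X \<in> matrices F \<beta>' \<beta>" "Y \<in> matrices F \<beta>' \<beta>"
  shows "matrix_class F \<beta>' \<beta> X = matrix_class F \<beta>' \<beta> Y \<longleftrightarrow> mat_mor \<beta>' \<beta> X = mat_mor \<beta>' \<beta> Y"
  unfolding matrix_class_def mat_mor_eq_iff[OF assms]
  using equiv_matrix_rel assms(3,4) by (rule eq_equiv_class_iff)

lemma mem_matrix_class_iff:
  assumes "\<beta>' \<in> barcodes R" "\<beta> \<in> barcodes R" "X \<in> matrices F \<beta>' \<beta>"
  shows "Y \<in> matrix_class F \<beta>' \<beta> X \<longleftrightarrow>
    Y \<in> matrices F \<beta>' \<beta> \<and> mat_mor \<beta>' \<beta> Y = mat_mor \<beta>' \<beta> X"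
  using mat_mor_eq_iff[OF assms, of Y] by (auto simp: matrix_class_def matrix_rel_def)

lemma Bcat_HomE:
  assumes "x \<in> Hom (Bcat F R) \<beta>' \<beta>"
  obtains X where "X \<in> matrices F \<beta>' \<beta>" "x = matrix_class F \<beta>' \<beta> X"
  using assms by (auto simp: Bcat_def matrix_class_def elim!: quotientE)

lemma matrix_class_in_Hom:
  "X \<in> matrices F \<beta>' \<beta> \<Longrightarrow> matrix_class F \<beta>' \<beta> X \<in> Hom (Bcat F R) \<beta>' \<beta>"
  by (auto simp: Bcat_def matrix_class_def intro: quotientI)

text \<open>Composition in \<open>Bcat\<close> is a union over all representatives, so it must be
  shown that all products have the same class. A class is determined by its morphism, and the
  morphism of a product depends only on the morphisms of the factors.\<close>

lemma Cmp_matrix_class: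
  fixes \<alpha> \<beta> \<gamma> :: "('i, 'r) barcode"
  assumes \<beta>: "\<alpha> \<in> barcodes R" "\<beta> \<in> barcodes R" "\<gamma> \<in> barcodes R"
    and X: "X \<in> matrices F \<beta> \<gamma>" and Y: "Y \<in> matrices F \<alpha> \<beta>"
  shows "Cmp (Bcat F R) \<alpha> \<beta> \<gamma> (matrix_class F \<beta> \<gamma> X) (matrix_class F \<alpha> \<beta> Y) =
    matrix_class F \<alpha> \<gamma> (matrix_mult F (dom \<gamma>) (dom \<beta>) (dom \<alpha>) X Y)"
proof -
  let ?m = "\<lambda>X Y. matrix_mult F (dom \<gamma>) (dom \<beta>) (dom \<alpha>) X Y"
  have "matrix_class F \<alpha> \<gamma> (?m X' Y') = matrix_class F \<alpha> \<gamma> (?m X Y)"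
    if "X' \<in> matrix_class F \<beta> \<gamma> X" "Y' \<in> matrix_class F \<alpha> \<beta> Y" for X' Y'
  proof -
    have *: "X' \<in> matrices F \<beta> \<gamma>" "mat_mor \<beta> \<gamma> X' = mat_mor \<beta> \<gamma> X"
      "Y' \<in> matrices F \<alpha> \<beta>" "mat_mor \<alpha> \<beta> Y' = mat_mor \<alpha> \<beta> Y"
      using that mem_matrix_class_iff[OF \<beta>(2,3) X] mem_matrix_class_iff[OF \<beta>(1,2) Y] by auto
    then show ?thesis
      using \<beta> X Y
      by (subst matrix_class_eq_iff) (simp_all add: matrix_mult_in_matrices mat_mor_matrix_mult)
  qed
  moreover have "X \<in> matrix_class F \<beta> \<gamma> X" "Y \<in> matrix_class F \<alpha> \<beta> Y"
    using mem_matrix_class_iff[OF \<beta>(2,3) X] mem_matrix_class_iff[OF \<beta>(1,2) Y] X Y by auto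
  ultimately show ?thesis
    unfolding Bcat_def cat.select_convs by blast
qed

end

section \<open>The equivalence\<close>

context interval_sums
begin

lemma Pcat_simps:
  "Hom (Pcat F R e) = pmod_morphisms F R"
  "Idn (Pcat F R e) = Idn (pmod_category F R)"
  "Cmp (Pcat F R e) = Cmp (pmod_category F R)"
  by (simp_all add: Pcat_def full_subcategory_def pmod_category_def)

text \<open>All representatives of a class act as the same morphism, so the description in
  \<open>interval_functor\<close> can be evaluated at any of them.\<close>

lemma FArr_interval_functor:
  assumes \<beta>: "\<beta>' \<in> barcodes R" "\<beta> \<in> barcodes R" and X: "X \<in> matrices F \<beta>' \<beta>"
  shows "FArr (interval_functor F R e) \<beta>' \<beta> (matrix_class F \<beta>' \<beta> X) = mat_mor \<beta>' \<beta> X"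
  unfolding interval_functor_def func.select_convs
proof (rule the_equality)
  show "mat_mor \<beta>' \<beta> X \<in> pmod_morphisms F R (isum \<beta>') (isum \<beta>) \<and>
      (\<exists>Y\<in>matrix_class F \<beta>' \<beta> X. computed_by F R e \<beta>' \<beta> (mat_mor \<beta>' \<beta> X) Y)"
    using mat_mor_in_Hom[OF assms] computed_by_mat_mor[OF assms] mem_matrix_class_iff[OF assms] X
    by blast
  fix \<phi> assume "\<phi> \<in> pmod_morphisms F R (isum \<beta>') (isum \<beta>) \<and>
      (\<exists>Y\<in>matrix_class F \<beta>' \<beta> X. computed_by F R e \<beta>' \<beta> \<phi> Y)"
  then show "\<phi> = mat_mor \<beta>' \<beta> X"
    using mem_matrix_class_iff[OF assms] computed_by_iff[OF \<beta>] by auto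
qed

text \<open>
  Matrix classes embed faithfully into morphisms of persistence modules, compatibly with
  composition, so the category laws are inherited.
\<close>

lemma category_Bcat: "category (Bcat F R :: (('i, 'r) barcode, ('i \<times> 'i \<Rightarrow> 'f) set) cat)"
proof -
  interpret P: category "pmod_category F R :: (('r, 'f, 'v) pmod, 'r \<Rightarrow> 'v \<Rightarrow> 'v) cat"
    by (rule category_pmod)
  have isum_Ob: "isum \<beta> \<in> Ob (pmod_category F R)" if "\<beta> \<in> barcodes R" for \<beta>
    using persistence_module_isum[OF that] by (simp add: pmod_category_simps)
  have mor: "mat_mor \<beta>' \<beta> X \<in> Hom (pmod_category F R) (isum \<beta>') (isum \<beta>)"
    if "\<beta>' \<in> barcodes R" "\<beta> \<in> barcodes R" "X \<in> matrices F \<beta>' \<beta>" for \<beta>' \<beta> X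
    using mat_mor_in_Hom[OF that] by (simp add: pmod_category_simps)
  have Ob: "Ob (Bcat F R) = barcodes R"
    and Idn: "Idn (Bcat F R) \<beta> = matrix_class F \<beta> \<beta> (identity_matrix F (dom \<beta>))"
    for \<beta> :: "('i, 'r) barcode"
    by (simp_all add: Bcat_def)
  show ?thesis
  proof (unfold_locales, unfold Ob Idn)
    fix \<alpha> :: "('i, 'r) barcode" assume "\<alpha> \<in> barcodes R"
    then show "matrix_class F \<alpha> \<alpha> (identity_matrix F (dom \<alpha>)) \<in> Hom (Bcat F R) \<alpha> \<alpha>"
      by (intro matrix_class_in_Hom identity_matrix_in_matrices)
  next
    fix \<alpha> \<beta> \<gamma> :: "('i, 'r) barcode" and x y
    assume *: "\<alpha> \<in> barcodes R" "\<beta> \<in> barcodes R" "\<gamma> \<in> barcodes R"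
      and "x \<in> Hom (Bcat F R) \<alpha> \<beta>" "y \<in> Hom (Bcat F R) \<beta> \<gamma>"
    then obtain X Y where "X \<in> matrices F \<alpha> \<beta>" "x = matrix_class F \<alpha> \<beta> X"
      "Y \<in> matrices F \<beta> \<gamma>" "y = matrix_class F \<beta> \<gamma> Y"
      by (metis Bcat_HomE)
    with * show "Cmp (Bcat F R) \<alpha> \<beta> \<gamma> y x \<in> Hom (Bcat F R) \<alpha> \<gamma>"
      by (simp add: Cmp_matrix_class matrix_class_in_Hom matrix_mult_in_matrices)
  next
    fix \<alpha> \<beta> :: "('i, 'r) barcode" and x
    assume *: "\<alpha> \<in> barcodes R" "\<beta> \<in> barcodes R" and "x \<in> Hom (Bcat F R) \<alpha> \<beta>"
    then obtain X where X: "X \<in> matrices F \<alpha> \<beta>" and x: "x = matrix_class F \<alpha> \<beta> X"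
      by (metis Bcat_HomE)
    note [simp] = * X identity_matrix_in_matrices isum_Ob mor
    show "Cmp (Bcat F R) \<alpha> \<beta> \<beta> (matrix_class F \<beta> \<beta> (identity_matrix F (dom \<beta>))) x = x"
      by (simp add: x Cmp_matrix_class matrix_class_eq_iff matrix_mult_in_matrices
          mat_mor_matrix_mult mat_mor_identity_matrix P.Cmp_Idn_left)
    show "Cmp (Bcat F R) \<alpha> \<alpha> \<beta> x (matrix_class F \<alpha> \<alpha> (identity_matrix F (dom \<alpha>))) = x"
      by (simp add: x Cmp_matrix_class matrix_class_eq_iff matrix_mult_in_matrices
          mat_mor_matrix_mult mat_mor_identity_matrix P.Cmp_Idn_right)
  next
    fix \<alpha> \<beta> \<gamma> \<delta> :: "('i, 'r) barcode" and x y z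
    assume *: "\<alpha> \<in> barcodes R" "\<beta> \<in> barcodes R" "\<gamma> \<in> barcodes R" "\<delta> \<in> barcodes R"
      and "x \<in> Hom (Bcat F R) \<alpha> \<beta>" "y \<in> Hom (Bcat F R) \<beta> \<gamma>" "z \<in> Hom (Bcat F R) \<gamma> \<delta>"
    then obtain X Y Z where X: "X \<in> matrices F \<alpha> \<beta>" "Y \<in> matrices F \<beta> \<gamma>" "Z \<in> matrices F \<gamma> \<delta>"
      and x: "x = matrix_class F \<alpha> \<beta> X" "y = matrix_class F \<beta> \<gamma> Y" "z = matrix_class F \<gamma> \<delta> Z"
      by (metis Bcat_HomE)
    note [simp] = * X isum_Ob mor
    show "Cmp (Bcat F R) \<alpha> \<gamma> \<delta> z (Cmp (Bcat F R) \<alpha> \<beta> \<gamma> y x) =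
        Cmp (Bcat F R) \<alpha> \<beta> \<delta> (Cmp (Bcat F R) \<beta> \<gamma> \<delta> z y) x"
      by (simp add: x Cmp_matrix_class matrix_class_eq_iff matrix_mult_in_matrices
          mat_mor_matrix_mult P.Cmp_assoc)
  qed
qed

lemma functor_interval: "is_functor (Bcat F R) (Pcat F R e) (interval_functor F R e)"
proof -
  interpret B: category "Bcat F R :: (('i, 'r) barcode, ('i \<times> 'i \<Rightarrow> 'f) set) cat"
    by (rule category_Bcat)
  interpret P: category "Pcat F R e" by (rule category_Pcat)
  have FOb: "FOb (interval_functor F R e) = isum"
    by (simp add: interval_functor_def)
  have Ob: "Ob (Bcat F R) = barcodes R"
    and Idn: "Idn (Bcat F R) \<beta> = matrix_class F \<beta> \<beta> (identity_matrix F (dom \<beta>))"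
    for \<beta> :: "('i, 'r) barcode"
    by (simp_all add: Bcat_def)
  show ?thesis
  proof (unfold_locales, unfold FOb Ob Idn)
    fix \<alpha> :: "('i, 'r) barcode" assume \<alpha>: "\<alpha> \<in> barcodes R"
    then show "isum \<alpha> \<in> Ob (Pcat F R e)" by (rule isum_in_Pcat)
    show "FArr (interval_functor F R e) \<alpha> \<alpha> (matrix_class F \<alpha> \<alpha> (identity_matrix F (dom \<alpha>))) =
        Idn (Pcat F R e) (isum \<alpha>)"
      using \<alpha> by (simp add: FArr_interval_functor identity_matrix_in_matrices
          mat_mor_identity_matrix Pcat_simps)
  next
    fix \<alpha> \<beta> :: "('i, 'r) barcode" and x
    assume *: "\<alpha> \<in> barcodes R" "\<beta> \<in> barcodes R" and "x \<in> Hom (Bcat F R) \<alpha> \<beta>"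
    then obtain X where X: "X \<in> matrices F \<alpha> \<beta>" and x: "x = matrix_class F \<alpha> \<beta> X"
      by (metis Bcat_HomE)
    with * show "FArr (interval_functor F R e) \<alpha> \<beta> x \<in> Hom (Pcat F R e) (isum \<alpha>) (isum \<beta>)"
      by (simp add: FArr_interval_functor mat_mor_in_Hom Pcat_simps)
  next
    fix \<alpha> \<beta> \<gamma> :: "('i, 'r) barcode" and x y
    assume *: "\<alpha> \<in> barcodes R" "\<beta> \<in> barcodes R" "\<gamma> \<in> barcodes R"
      and "x \<in> Hom (Bcat F R) \<alpha> \<beta>" "y \<in> Hom (Bcat F R) \<beta> \<gamma>"
    then obtain X Y where "X \<in> matrices F \<alpha> \<beta>" "x = matrix_class F \<alpha> \<beta> X"
      "Y \<in> matrices F \<beta> \<gamma>" "y = matrix_class F \<beta> \<gamma> Y"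
      by (metis Bcat_HomE)
    with * show "FArr (interval_functor F R e) \<alpha> \<gamma> (Cmp (Bcat F R) \<alpha> \<beta> \<gamma> y x) =
        Cmp (Pcat F R e) (isum \<alpha>) (isum \<beta>) (isum \<gamma>)
          (FArr (interval_functor F R e) \<beta> \<gamma> y) (FArr (interval_functor F R e) \<alpha> \<beta> x)"
      by (simp add: Cmp_matrix_class FArr_interval_functor matrix_mult_in_matrices
          mat_mor_matrix_mult Pcat_simps)
  qed
qed

text \<open>Existence is \<open>mat_mor_surj\<close>; uniqueness holds because the relation on
  matrices is no finer than equality of the induced morphisms.\<close>

lemma interval_functor_fully_faithful:
  assumes \<beta>: "\<beta>' \<in> barcodes R" "\<beta> \<in> barcodes R"
    and \<phi>: "\<phi> \<in> pmod_morphisms F R (isum \<beta>') (isum \<beta>)"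
  shows "\<exists>!x. x \<in> Hom (Bcat F R) \<beta>' \<beta> \<and> FArr (interval_functor F R e) \<beta>' \<beta> x = \<phi>"
proof -
  obtain X where X: "X \<in> matrices F \<beta>' \<beta>" "\<phi> = mat_mor \<beta>' \<beta> X"
    using assms by (rule mat_mor_surj)
  show ?thesis
  proof (rule ex1I[of _ "matrix_class F \<beta>' \<beta> X"])
    show "matrix_class F \<beta>' \<beta> X \<in> Hom (Bcat F R) \<beta>' \<beta> \<and>
        FArr (interval_functor F R e) \<beta>' \<beta> (matrix_class F \<beta>' \<beta> X) = \<phi>"
      using X by (simp add: matrix_class_in_Hom FArr_interval_functor[OF \<beta>])
    fix x assume *: "x \<in> Hom (Bcat F R) \<beta>' \<beta> \<and> FArr (interval_functor F R e) \<beta>' \<beta> x = \<phi>"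
    then obtain Y where "Y \<in> matrices F \<beta>' \<beta>" "x = matrix_class F \<beta>' \<beta> Y"
      by (metis Bcat_HomE)
    with * X show "x = matrix_class F \<beta>' \<beta> X"
      by (simp add: FArr_interval_functor[OF \<beta>] matrix_class_eq_iff[OF \<beta>])
  qed
qed

end

theorem theorem8p2:
  fixes F :: "'f ring"
    and R :: "'r::linorder set"
    and e :: "('i \<Rightarrow> 'f) \<Rightarrow> 'v"
    and bc :: "('r, 'f, 'v) pmod \<Rightarrow> ('i, 'r) barcode"
    and \<theta> :: "('r, 'f, 'v) pmod \<Rightarrow> 'r \<Rightarrow> 'v \<Rightarrow> 'v"
  assumes "field F"
    and "infinite (UNIV :: 'i set)"
    and "inj e"
    and "interval_decompositions F R e bc \<theta>"
  shows "equivalence_of_categories (Pcat F R e) (Bcat F R)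
           (bar_functor F R e bc \<theta>) (interval_functor F R e)"
proof -
  interpret field F by (fact assms(1))
  interpret interval_sums F R e by unfold_locales (fact assms(3))
  interpret P: category "Pcat F R e" by (rule category_Pcat)
  let ?P = "Pcat F R e" and ?I = "interval_functor F R e" and ?G = "bar_functor F R e bc \<theta>"
  have FOb: "FOb ?I = isum" "FOb ?G = bc"
    by (simp_all add: interval_functor_def bar_functor_def)
  have Ob: "Ob (Bcat F R) = (barcodes R :: ('i, 'r) barcode set)" by (simp add: Bcat_def)
  have bc: "bc V \<in> barcodes R" and \<theta>: "iso_arrow ?P V (isum (bc V)) (\<theta> V)" if "V \<in> Ob ?P" for V
    using assms(4) that by (simp_all add: interval_decompositions_def)
  \<comment> \<open>These are the two requirements on the arrow part of \<open>G\<close> in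
    \<open>equivalence_of_fully_faithful\<close>: applying the interval functor to the class chosen
    by \<open>bar_functor\<close> gives back the conjugate of \<phi> by the chosen
    isomorphisms.\<close>
  have bar_arr: "FArr ?G U V \<phi> \<in> Hom (Bcat F R) (bc U) (bc V) \<and>
      FArr ?I (bc U) (bc V) (FArr ?G U V \<phi>) =
        Cmp ?P (isum (bc U)) V (isum (bc V)) (\<theta> V)
          (Cmp ?P (isum (bc U)) U V \<phi> (inverse_arrow ?P U (isum (bc U)) (\<theta> U)))"
    if UV: "U \<in> Ob ?P" "V \<in> Ob ?P" and \<phi>: "\<phi> \<in> Hom ?P U V" for U V \<phi>
  proof -
    let ?U' = "isum (bc U)" and ?V' = "isum (bc V)"
    note \<beta> = bc[OF UV(1)] bc[OF UV(2)]
    define \<psi> where "\<psi> = Cmp ?P ?U' V ?V' (\<theta> V) (Cmp ?P ?U' U V \<phi> (inverse_arrow ?P U ?U' (\<theta> U)))"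
    have Ob': "?U' \<in> Ob ?P" "?V' \<in> Ob ?P" using \<beta> by (simp_all add: isum_in_Pcat)
    have "inverse_arrow ?P U ?U' (\<theta> U) \<in> Hom ?P ?U' U" "\<theta> V \<in> Hom ?P V ?V'"
      using P.inverse_arrow_inverse[OF UV(1) Ob'(1) \<theta>[OF UV(1)]]
        P.inverse_arrow_inverse[OF UV(2) Ob'(2) \<theta>[OF UV(2)]]
      by (simp_all add: inverse_arrows_def)
    then have "\<psi> \<in> Hom ?P ?U' ?V'"
      unfolding \<psi>_def using UV Ob' \<phi> by (intro P.Cmp_in_Hom[of ?U' V ?V'] P.Cmp_in_Hom[of ?U' U V])
    then have \<psi>: "\<psi> \<in> pmod_morphisms F R ?U' ?V'" by (simp add: Pcat_simps)
    then obtain X where X: "X \<in> matrices F (bc U) (bc V)" "\<psi> = mat_mor (bc U) (bc V) X"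
      by (rule mat_mor_surj[OF \<beta>])
    have "FArr ?G U V \<phi> = (THE x. \<exists>X\<in>matrices F (bc U) (bc V).
        computed_by F R e (bc U) (bc V) \<psi> X \<and> x = matrix_class F (bc U) (bc V) X)"
      by (simp add: bar_functor_def Let_def \<psi>_def)
    also have "\<dots> = matrix_class F (bc U) (bc V) X"
    \<comment> \<open>Two matrices computing \<psi> induce the same morphism and so have the same
      class; this is the uniqueness of the barcode of a morphism.\<close>
    proof (rule the_equality)
      show "\<exists>Y\<in>matrices F (bc U) (bc V). computed_by F R e (bc U) (bc V) \<psi> Y \<and>
          matrix_class F (bc U) (bc V) X = matrix_class F (bc U) (bc V) Y"
        using X computed_by_mat_mor[OF \<beta> X(1)] by blast
      fix x assume "\<exists>Y\<in>matrices F (bc U) (bc V). computed_by F R e (bc U) (bc V) \<psi> Y \<and>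
          x = matrix_class F (bc U) (bc V) Y"
      then show "x = matrix_class F (bc U) (bc V) X"
        using X computed_by_iff[OF \<beta> _ \<psi>] matrix_class_eq_iff[OF \<beta>] by auto
    qed
    finally show ?thesis
      using X by (simp add: matrix_class_in_Hom FArr_interval_functor[OF \<beta>] \<psi>_def)
  qed
  show ?thesis
  proof (rule equivalence_of_fully_faithful[OF functor_interval, where \<theta> = \<theta>], unfold FOb Ob)
    fix \<beta>' \<beta> :: "('i, 'r) barcode" and \<phi>
    assume "\<beta>' \<in> barcodes R" "\<beta> \<in> barcodes R" "\<phi> \<in> Hom ?P (isum \<beta>') (isum \<beta>)"
    then show "\<exists>!x. x \<in> Hom (Bcat F R) \<beta>' \<beta> \<and> FArr ?I \<beta>' \<beta> x = \<phi>"
      by (intro interval_functor_fully_faithful) (simp_all add: Pcat_simps)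
  qed (simp_all add: bc \<theta> bar_arr)
qed

end
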